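(* Let $\{(x^k,\xi^k,\lambda^{k+1})\}_{k\in\mathbb N}$ be generated by the inexact MBA algorithm described in the context. Suppose that $\{x^k\}_{k\in\mathbb N}$ is bounded, that the system $g(x)\in\mathbb{R}_-^m$ satisfies the MFCQ at all points of $\Gamma$, and that $\nabla f,\nabla g_1,\ldots,\nabla g_m$ are Lipschitz continuous on $\mathcal{O}$ with Lipschitz constants $L_f,L_{g_1},\ldots,L_{g_m}$, respectively. Let $L_g:=\|(L_{g_1},\ldots,L_{g_m})\|$ and let $\widehat c_R,\beta_\lambda,\beta_L,\beta_{\mathcal Q}>0$ be constants such that $\frac{\beta_R}{2}\|x^{k+1}-x^k\|\le\widehat c_R$, $\|\lambda^{k+1}\|\le\beta_\lambda$, $\|L^k\|\le\beta_L$ and $\|\mathcal{Q}_k\|\le\beta_{\mathcal Q}$ for all $k\in\mathbb{N}$ (such constants exist under these hypotheses). Set $$C:=\max\Big\{L_f+\widehat c_R+\beta_{\mathcal Q}+\beta_\lambda(L_g+\beta_L),\ 1,\ \sqrt{\tfrac{\beta_\lambda(L_g+\beta_L)+\beta_R}{2}}\Big\},\qquad {\rm val}^*:=\inf_{x\in\Gamma}F(x).$$ Then for any $K\in\mathbb{N}$, $$\min_{0\le k\le K}\chi(x^{k+1},\xi^k,\lambda^{k+1})\le\frac{C}{\sqrt{K+1}}\sqrt{\frac{2(F(x^0)-{\rm val}^* )}{\alpha}}.$$ So, for any $\epsilon>0$, an $\epsilon$-KKT point is achieved within $\Big\lceil\frac{2C^2(F(x^0)-{\rm val}^* )}{\alpha\epsilon^2}-1\Big\rceil$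 steps, i.e., for every $K\in\mathbb{N}$ at least as large as this number, one of the triples $(x^{k+1},\xi^k,\lambda^{k+1})$, $0\le k\le K$, is an $\epsilon$-KKT point.
   Context: Problem and standing assumptions. Consider $\min_{x\in\mathbb{R}^n}F(x):=f(x)+\phi(x)-\psi(x)+\delta_{\mathbb{R}_-^m}(g(x))$, where $\delta_C$ is the indicator function of $C$ and: (i) $g:\mathbb{R}^n\to\mathbb{R}^m$ is $\mathcal{C}^{1,1}$ (differentiable with locally Lipschitz derivative) and $\Gamma:=g^{-1}(\mathbb{R}_-^m)\neq\emptyset$; (ii) $f:\mathbb{R}^n\to(-\infty,\infty]$ is proper lsc and $\mathcal{C}^{1,1}$ on an open convex set $\mathcal{O}\supset\Gamma$; (iii) $\phi,\psi:\mathbb{R}^n\to\mathbb{R}$ are convex; (iv) $\inf_{\Gamma}F>-\infty$. $\partial$ denotes the limiting subdifferential, $\mathcal{N}_C$ the limiting normal cone, $\nabla g(x):=g'(x)^\top$, $t_+=\max\{0,t\}$ (componentwise for vectors), $\psi^*$ the conjugate of $\psi$. The system $g(x)\in\mathbb{R}^m_-$ satisfies the MFCQ at $x\in\Gamma$ if ${\rm Ker}(\nabla g(x))\cap\mathcal{N}_{\mathbb{R}^m_-}(g(x))=\{0\}$. Algorithm (inexact MBA). Let $G(x,s,L):=g(s)+g'(s)(x-s)+\frac12\|x-s\|^2L$ for $x,s\in\mathbb{R}^n$, $L\in\mathbb{R}^m_{++}$. Input: $0<\mu_{\min}\le\mu_{\max}$, $0<L_{\min}\le L_{\max}$, $M,\beta_R,\beta_F,\alpha>0$,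 $\tau>1$, $x^0\in\Gamma$. For $k=0,1,2,\ldots$: choose $\xi^k\in\partial(-\psi)(x^k)$, $\mu_{k,0}\in[\mu_{\min},\mu_{\max}]$, $L^{k,0}\in\mathbb{R}^m$ with entries in $[L_{\min},L_{\max}]$. Inner loop, $j=0,1,2,\ldots$: choose a self-adjoint linear $\mathcal{Q}_{k,j}:\mathbb{R}^n\to\mathbb{R}^n$ with $\mu_{k,j}\mathcal{I}\preceq\mathcal{Q}_{k,j}\preceq(\mu_{k,j}+M)\mathcal{I}$; put $\vartheta_{k,j}(x):=f(x^k)-\psi(x^k)+\langle\nabla f(x^k)+\xi^k,x-x^k\rangle+\frac12\langle x-x^k,\mathcal{Q}_{k,j}(x-x^k)\rangle$, $F_{k,j}:=\vartheta_{k,j}+\phi$, $\Gamma_{k,j}:=\{x: G(x,x^k,L^{k,j})\le0\}$, and let $\overline{x}^{k,j}$ be the unique minimizer of $F_{k,j}$ on $\Gamma_{k,j}$. Find $y^{k,j}\in\mathbb{R}^n$, $v^{k,j}\in\partial\phi(y^{k,j})$, $\lambda^{k,j}\in\mathbb{R}^m_+$ with $R_{k,j}(y^{k,j},v^{k,j},\lambda^{k,j})\le\frac{\beta_R}{2}\|y^{k,j}-x^k\|^2$, $F_{k,j}(y^{k,j})\le F_{k,j}(x^k)$ and $F_{k,j}(y^{k,j})-F_{k,j}(\overline{x}^{k,j})\le\frac{\beta_F}{2}\|y^{k,j}-x^k\|^2$, where, with $r:=\nabla\vartheta_{k,j}(x)+v+\nabla_xG(x,x^k,L^{k,j})\lambda$,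 $R_{k,j}(x,v,\lambda):=(\langle x,r\rangle)_++(-\langle\lambda,G(x,x^k,L^{k,j})\rangle)_++\|r\|+\|[G(x,x^k,L^{k,j})]_+\|_\infty$. If $g(y^{k,j})\le0$ and $F(y^{k,j})\le F(x^k)-\frac\alpha2\|y^{k,j}-x^k\|^2$, set $j_k:=j$ and leave the inner loop; else if $g(y^{k,j})\not\le0$, set $L^{k,j+1}=\tau L^{k,j}$, $\mu_{k,j+1}=\mu_{k,j}$; else set $L^{k,j+1}=L^{k,j}$, $\mu_{k,j+1}=\tau\mu_{k,j}$. After the inner loop set $(\mu_k,L^k,\mathcal{Q}_k,\overline{x}^k):=(\mu_{k,j_k},L^{k,j_k},\mathcal{Q}_{k,j_k},\overline{x}^{k,j_k})$ and $(x^{k+1},v^{k+1},\lambda^{k+1}):=(y^{k,j_k},v^{k,j_k},\lambda^{k,j_k})$. Approximate KKT points. Let $\mathcal{L}(x,\xi,\lambda):=f(x)+\phi(x)+\langle x,\xi\rangle+\psi^*(-\xi)+\langle\lambda,g(x)\rangle$, so $\partial_x\mathcal{L}(x,\xi,\lambda)=\nabla f(x)+\partial\phi(x)+\xi+\nabla g(x)\lambda$ and $\partial_\xi\mathcal{L}(x,\xi,\lambda)=x-\partial\psi^*(-\xi)$. For $(x,\xi,\lambda)\in\Gamma\times(-{\rm dom}\,\psi^* )\times\mathbb{R}^m_+$, $\chi(x,\xi,\lambda):=\max\{{\rm dist}(0,\partial_x\mathcal{L}(x,\xi,\lambda)),{\rm dist}(0,\partial_\xi\mathcal{L}(x,\xi,\lambda)),\sqrt{-\langle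 g(x),\lambda\rangle}\}$; such a triple is an $\epsilon$-KKT point if $\chi(x,\xi,\lambda)\le\epsilon$. *)

theory Defs
  imports "HOL-Analysis.Analysis"
begin

section \<open>Smooth calculus\<close>

definition grad :: "('a::real_inner \<Rightarrow> real) \<Rightarrow> 'a \<Rightarrow> 'a" where
  "grad h x = (THE D. GDERIV h x :> D)"

text \<open>For vector-valued \<open>h\<close>, \<open>jac_transp h x\<close> is the transpose of the derivative \<open>h'(x)\<close>;
  in particular it is \<open>\<nabla>g(x) = g'(x)\<^sup>T\<close> for the constraint mapping.\<close>

definition jac_transp :: "('a::real_inner \<Rightarrow> 'b::real_inner) \<Rightarrow> 'a \<Rightarrow> 'b \<Rightarrow> 'a" where
  "jac_transp h x = adjoint (frechet_derivative h (at x))"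

definition C11_on :: "'a set \<Rightarrow> ('a::real_normed_vector \<Rightarrow> 'b::real_normed_vector) \<Rightarrow> bool" where
  "C11_on S h \<longleftrightarrow> (\<exists>h' :: 'a \<Rightarrow> 'a \<Rightarrow>\<^sub>L 'b.
     (\<forall>x\<in>S. (h has_derivative blinfun_apply (h' x)) (at x)) \<and>
     (\<forall>x\<in>S. \<exists>e>0. \<exists>K. K-lipschitz_on (ball x e \<inter> S) h'))"


section \<open>Variational analysis of extended-real-valued functions\<close>

definition proper :: "('a \<Rightarrow> ereal) \<Rightarrow> bool" where
  "proper h \<longleftrightarrow> (\<forall>x. h x \<noteq> -\<infinity>) \<and> (\<exists>x. h x \<noteq> \<infinity>)"

definition lower_semicont :: "('a::topological_space \<Rightarrow> ereal) \<Rightarrow> bool" where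
  "lower_semicont h \<longleftrightarrow> (\<forall>x. h x \<le> Liminf (at x) h)"

definition regular_subdiff :: "('a::euclidean_space \<Rightarrow> ereal) \<Rightarrow> 'a \<Rightarrow> 'a set" where
  "regular_subdiff h x = {v. \<bar>h x\<bar> \<noteq> \<infinity> \<and>
     0 \<le> Liminf (at x) (\<lambda>z. (h z - h x - ereal (v \<bullet> (z - x))) / ereal (norm (z - x)))}"

definition limiting_subdiff :: "('a::euclidean_space \<Rightarrow> ereal) \<Rightarrow> 'a \<Rightarrow> 'a set" where
  "limiting_subdiff h x = {v. \<bar>h x\<bar> \<noteq> \<infinity> \<and>
     (\<exists>X V. X \<longlonglongrightarrow> x \<and> (\<lambda>k. h (X k)) \<longlonglongrightarrow> h x \<and>
            (\<forall>k. V k \<in> regular_subdiff h (X k)) \<and> V \<longlonglongrightarrow> v)}"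

definition set_ind :: "'a set \<Rightarrow> 'a \<Rightarrow> ereal" where
  "set_ind C x = (if x \<in> C then 0 else \<infinity>)"

definition limiting_normal_cone :: "'a::euclidean_space set \<Rightarrow> 'a \<Rightarrow> 'a set" where
  "limiting_normal_cone C = limiting_subdiff (set_ind C)"

definition conjugate :: "('a::real_inner \<Rightarrow> real) \<Rightarrow> 'a \<Rightarrow> ereal" where
  "conjugate h y = (SUP z. ereal (y \<bullet> z - h z))"

text \<open>The distance of the origin to a set is \<open>\<infinity>\<close> for the empty set, whereas
  \<^const>\<open>infdist\<close> would return \<open>0\<close>.\<close>

definition dist0 :: "'a::real_normed_vector set \<Rightarrow> ereal" where
  "dist0 S = (INF v\<in>S. ereal (norm v))"


section \<open>The optimization problem\<close>

text \<open>The order on \<^typ>\<open>real ^ 'm\<close> is componentwise, so \<open>{..0}\<close> is the nonpositive orthant.\<close>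

definition feasible :: "(real ^ 'n \<Rightarrow> real ^ 'm) \<Rightarrow> (real ^ 'n) set" where
  "feasible g = g -` {..0}"

definition objective :: "(real ^ 'n \<Rightarrow> ereal) \<Rightarrow> (real ^ 'n \<Rightarrow> real ^ 'm) \<Rightarrow>
    (real ^ 'n \<Rightarrow> real) \<Rightarrow> (real ^ 'n \<Rightarrow> real) \<Rightarrow> real ^ 'n \<Rightarrow> ereal" where
  "objective f g \<phi> \<psi> x = f x + ereal (\<phi> x) - ereal (\<psi> x) + set_ind {..0} (g x)"

definition opt_val :: "(real ^ 'n \<Rightarrow> ereal) \<Rightarrow> (real ^ 'n \<Rightarrow> real ^ 'm) \<Rightarrow>
    (real ^ 'n \<Rightarrow> real) \<Rightarrow> (real ^ 'n \<Rightarrow> real) \<Rightarrow> ereal" where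
  "opt_val f g \<phi> \<psi> = (INF x\<in>feasible g. objective f g \<phi> \<psi> x)"

definition MFCQ_at :: "(real ^ 'n \<Rightarrow> real ^ 'm) \<Rightarrow> real ^ 'n \<Rightarrow> bool" where
  "MFCQ_at g x \<longleftrightarrow> {w. jac_transp g x w = 0} \<inter> limiting_normal_cone {..0} (g x) = {0}"

locale DC_problem =
  fixes f :: "real ^ 'n \<Rightarrow> ereal"
    and g :: "real ^ 'n \<Rightarrow> real ^ 'm"
    and \<phi> \<psi> :: "real ^ 'n \<Rightarrow> real"
    and U :: "(real ^ 'n) set"
  assumes g_C11: "C11_on UNIV g"
    and feasible_nonempty: "feasible g \<noteq> {}"
    and f_proper: "proper f"
    and f_lsc: "lower_semicont f"
    and U_open: "open U"
    and U_convex: "convex U"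
    and feasible_subset: "feasible g \<subseteq> U"
    and f_finite: "\<And>x. x \<in> U \<Longrightarrow> \<bar>f x\<bar> \<noteq> \<infinity>"
    and f_C11: "C11_on U (\<lambda>x. real_of_ereal (f x))"
    and \<phi>_convex: "convex_on UNIV \<phi>"
    and \<psi>_convex: "convex_on UNIV \<psi>"
    and val_bounded_below: "opt_val f g \<phi> \<psi> > -\<infinity>"


section \<open>The inexact moving balls approximation algorithm\<close>

definition MBA_G :: "(real ^ 'n \<Rightarrow> real ^ 'm) \<Rightarrow> real ^ 'n \<Rightarrow> real ^ 'n \<Rightarrow> real ^ 'm \<Rightarrow> real ^ 'm" where
  "MBA_G g x s L = g s + frechet_derivative g (at s) (x - s) + ((norm (x - s))\<^sup>2 / 2) *\<^sub>R L"

definition MBA_theta :: "(real ^ 'n \<Rightarrow> ereal) \<Rightarrow> (real ^ 'n \<Rightarrow> real) \<Rightarrow> real ^ 'n \<Rightarrow> real ^ 'n \<Rightarrow>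
    (real ^ 'n \<Rightarrow> real ^ 'n) \<Rightarrow> real ^ 'n \<Rightarrow> real" where
  "MBA_theta f \<psi> s \<xi> Q x = real_of_ereal (f s) - \<psi> s
     + (grad (\<lambda>z. real_of_ereal (f z)) s + \<xi>) \<bullet> (x - s) + (x - s) \<bullet> Q (x - s) / 2"

definition MBA_model :: "(real ^ 'n \<Rightarrow> ereal) \<Rightarrow> (real ^ 'n \<Rightarrow> real) \<Rightarrow> (real ^ 'n \<Rightarrow> real) \<Rightarrow>
    real ^ 'n \<Rightarrow> real ^ 'n \<Rightarrow> (real ^ 'n \<Rightarrow> real ^ 'n) \<Rightarrow> real ^ 'n \<Rightarrow> real" where
  "MBA_model f \<phi> \<psi> s \<xi> Q x = MBA_theta f \<psi> s \<xi> Q x + \<phi> x"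

definition MBA_feasible :: "(real ^ 'n \<Rightarrow> real ^ 'm) \<Rightarrow> real ^ 'n \<Rightarrow> real ^ 'm \<Rightarrow> (real ^ 'n) set" where
  "MBA_feasible g s L = {x. MBA_G g x s L \<le> 0}"

definition MBA_R :: "(real ^ 'n \<Rightarrow> ereal) \<Rightarrow> (real ^ 'n \<Rightarrow> real ^ 'm) \<Rightarrow> (real ^ 'n \<Rightarrow> real) \<Rightarrow>
    real ^ 'n \<Rightarrow> real ^ 'n \<Rightarrow> (real ^ 'n \<Rightarrow> real ^ 'n) \<Rightarrow> real ^ 'm \<Rightarrow>
    real ^ 'n \<Rightarrow> real ^ 'n \<Rightarrow> real ^ 'm \<Rightarrow> real" where
  "MBA_R f g \<psi> s \<xi> Q L x v lam =
    (let r = grad (MBA_theta f \<psi> s \<xi> Q) x + v + jac_transp (\<lambda>z. MBA_G g z s L) x lam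
     in max 0 (x \<bullet> r) + max 0 (- (lam \<bullet> MBA_G g x s L)) + norm r
        + infnorm (\<chi> i. max 0 (MBA_G g x s L $ i)))"

definition MBA_accept :: "(real ^ 'n \<Rightarrow> ereal) \<Rightarrow> (real ^ 'n \<Rightarrow> real ^ 'm) \<Rightarrow> (real ^ 'n \<Rightarrow> real) \<Rightarrow>
    (real ^ 'n \<Rightarrow> real) \<Rightarrow> real \<Rightarrow> real ^ 'n \<Rightarrow> real ^ 'n \<Rightarrow> bool" where
  "MBA_accept f g \<phi> \<psi> \<alpha> s y \<longleftrightarrow> g y \<le> 0 \<and>
     objective f g \<phi> \<psi> y \<le> objective f g \<phi> \<psi> s - ereal (\<alpha> / 2 * (norm (y - s))\<^sup>2)"

text \<open>The locale describes the runs of the algorithm. The doubly indexed sequences are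
  indexed by the outer iteration \<open>k\<close> and the inner iteration \<open>j\<close>; they are constrained for
  \<open>j \<le> jj k\<close> only, where \<open>jj k\<close> is the inner iteration at which the inner loop stops. The
  sequences denoted \<open>\<mu>\<^sub>k\<close>, \<open>L\<^sup>k\<close>, \<open>Q\<^sub>k\<close>, \<open>v\<^sup>k\<^sup>+\<^sup>1\<close>, \<open>\<lambda>\<^sup>k\<^sup>+\<^sup>1\<close> with one index are
  \<open>\<mu> k (jj k)\<close>, \<open>L k (jj k)\<close>, \<open>Q k (jj k)\<close>, \<open>v k (jj k)\<close>, \<open>lam k (jj k)\<close>.\<close>

locale inexact_MBA = DC_problem f g \<phi> \<psi> U
  for f :: "real ^ 'n \<Rightarrow> ereal"
    and g :: "real ^ 'n \<Rightarrow> real ^ 'm"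
    and \<phi> \<psi> :: "real ^ 'n \<Rightarrow> real"
    and U :: "(real ^ 'n) set" +
  fixes \<mu>min \<mu>max Lmin Lmax M \<beta>\<^sub>R \<beta>\<^sub>F \<alpha> \<tau> :: real
    and x \<xi> :: "nat \<Rightarrow> real ^ 'n"
    and jj :: "nat \<Rightarrow> nat"
    and \<mu> :: "nat \<Rightarrow> nat \<Rightarrow> real"
    and L :: "nat \<Rightarrow> nat \<Rightarrow> real ^ 'm"
    and Q :: "nat \<Rightarrow> nat \<Rightarrow> real ^ 'n \<Rightarrow> real ^ 'n"
    and xbar y v :: "nat \<Rightarrow> nat \<Rightarrow> real ^ 'n"
    and lam :: "nat \<Rightarrow> nat \<Rightarrow> real ^ 'm"
  assumes params:
      "0 < \<mu>min" "\<mu>min \<le> \<mu>max" "0 < Lmin" "Lmin \<le> Lmax"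
      "0 < M" "0 < \<beta>\<^sub>R" "0 < \<beta>\<^sub>F" "0 < \<alpha>" "1 < \<tau>"
    and x0: "x 0 \<in> feasible g"
    and \<xi>: "\<And>k. \<xi> k \<in> limiting_subdiff (\<lambda>z. ereal (- \<psi> z)) (x k)"
    and \<mu>_init: "\<And>k. \<mu> k 0 \<in> {\<mu>min..\<mu>max}"
    and L_init: "\<And>k i. L k 0 $ i \<in> {Lmin..Lmax}"
    and Q_linear: "\<And>k j. j \<le> jj k \<Longrightarrow> linear (Q k j)"
    and Q_selfadjoint: "\<And>k j a b. j \<le> jj k \<Longrightarrow> Q k j a \<bullet> b = a \<bullet> Q k j b"
    and Q_bounds: "\<And>k j d. j \<le> jj k \<Longrightarrow>
      \<mu> k j * (d \<bullet> d) \<le> d \<bullet> Q k j d \<and> d \<bullet> Q k j d \<le> (\<mu> k j + M) * (d \<bullet> d)"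
    and xbar: "\<And>k j. j \<le> jj k \<Longrightarrow>
      is_arg_min (MBA_model f \<phi> \<psi> (x k) (\<xi> k) (Q k j)) (\<lambda>z. z \<in> MBA_feasible g (x k) (L k j)) (xbar k j)"
    and v: "\<And>k j. j \<le> jj k \<Longrightarrow> v k j \<in> limiting_subdiff (\<lambda>z. ereal (\<phi> z)) (y k j)"
    and lam_nonneg: "\<And>k j. j \<le> jj k \<Longrightarrow> 0 \<le> lam k j"
    and R_bound: "\<And>k j. j \<le> jj k \<Longrightarrow>
      MBA_R f g \<psi> (x k) (\<xi> k) (Q k j) (L k j) (y k j) (v k j) (lam k j)
        \<le> \<beta>\<^sub>R / 2 * (norm (y k j - x k))\<^sup>2"
    and model_decrease: "\<And>k j. j \<le> jj k \<Longrightarrow>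
      MBA_model f \<phi> \<psi> (x k) (\<xi> k) (Q k j) (y k j) \<le> MBA_model f \<phi> \<psi> (x k) (\<xi> k) (Q k j) (x k)"
    and model_gap: "\<And>k j. j \<le> jj k \<Longrightarrow>
      MBA_model f \<phi> \<psi> (x k) (\<xi> k) (Q k j) (y k j)
        - MBA_model f \<phi> \<psi> (x k) (\<xi> k) (Q k j) (xbar k j)
        \<le> \<beta>\<^sub>F / 2 * (norm (y k j - x k))\<^sup>2"
    and inner_continue: "\<And>k j. j < jj k \<Longrightarrow> \<not> MBA_accept f g \<phi> \<psi> \<alpha> (x k) (y k j)"
    and inner_update_infeasible: "\<And>k j. j < jj k \<Longrightarrow> \<not> g (y k j) \<le> 0 \<Longrightarrow>
      L k (Suc j) = \<tau> *\<^sub>R L k j \<and> \<mu> k (Suc j) = \<mu> k j"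
    and inner_update_feasible: "\<And>k j. j < jj k \<Longrightarrow> g (y k j) \<le> 0 \<Longrightarrow>
      L k (Suc j) = L k j \<and> \<mu> k (Suc j) = \<tau> * \<mu> k j"
    and inner_stop: "\<And>k. MBA_accept f g \<phi> \<psi> \<alpha> (x k) (y k (jj k))"
    and x_update: "\<And>k. x (Suc k) = y k (jj k)"

definition MBA_iterate_bounds :: "real \<Rightarrow> (nat \<Rightarrow> real ^ 'n) \<Rightarrow> (nat \<Rightarrow> real ^ 'm) \<Rightarrow>
    (nat \<Rightarrow> real ^ 'm) \<Rightarrow> (nat \<Rightarrow> real ^ 'n \<Rightarrow> real ^ 'n) \<Rightarrow> real \<Rightarrow> real \<Rightarrow> real \<Rightarrow> real \<Rightarrow> bool" where
  "MBA_iterate_bounds \<beta>\<^sub>R x lam L Q c\<^sub>R \<beta>\<^sub>l \<beta>\<^sub>L \<beta>\<^sub>Q \<longleftrightarrow>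
     c\<^sub>R > 0 \<and> \<beta>\<^sub>l > 0 \<and> \<beta>\<^sub>L > 0 \<and> \<beta>\<^sub>Q > 0 \<and>
     (\<forall>k. \<beta>\<^sub>R / 2 * norm (x (Suc k) - x k) \<le> c\<^sub>R \<and> norm (lam k) \<le> \<beta>\<^sub>l \<and>
          norm (L k) \<le> \<beta>\<^sub>L \<and> onorm (Q k) \<le> \<beta>\<^sub>Q)"


section \<open>Approximate KKT points\<close>

definition Lagrangian :: "(real ^ 'n \<Rightarrow> ereal) \<Rightarrow> (real ^ 'n \<Rightarrow> real ^ 'm) \<Rightarrow>
    (real ^ 'n \<Rightarrow> real) \<Rightarrow> (real ^ 'n \<Rightarrow> real) \<Rightarrow>
    real ^ 'n \<Rightarrow> real ^ 'n \<Rightarrow> real ^ 'm \<Rightarrow> ereal" where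
  "Lagrangian f g \<phi> \<psi> x \<xi> lam =
     f x + ereal (\<phi> x) + ereal (x \<bullet> \<xi>) + conjugate \<psi> (- \<xi>) + ereal (lam \<bullet> g x)"

definition KKT_residual :: "(real ^ 'n \<Rightarrow> ereal) \<Rightarrow> (real ^ 'n \<Rightarrow> real ^ 'm) \<Rightarrow>
    (real ^ 'n \<Rightarrow> real) \<Rightarrow> (real ^ 'n \<Rightarrow> real) \<Rightarrow>
    real ^ 'n \<Rightarrow> real ^ 'n \<Rightarrow> real ^ 'm \<Rightarrow> ereal" where
  "KKT_residual f g \<phi> \<psi> x \<xi> lam = Max {
     dist0 (limiting_subdiff (\<lambda>z. Lagrangian f g \<phi> \<psi> z \<xi> lam) x),
     dist0 (limiting_subdiff (\<lambda>\<zeta>. Lagrangian f g \<phi> \<psi> x \<zeta> lam) \<xi>),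
     ereal (sqrt (- (g x \<bullet> lam)))}"

definition eps_KKT_point :: "(real ^ 'n \<Rightarrow> ereal) \<Rightarrow> (real ^ 'n \<Rightarrow> real ^ 'm) \<Rightarrow>
    (real ^ 'n \<Rightarrow> real) \<Rightarrow> (real ^ 'n \<Rightarrow> real) \<Rightarrow> real \<Rightarrow>
    real ^ 'n \<Rightarrow> real ^ 'n \<Rightarrow> real ^ 'm \<Rightarrow> bool" where
  "eps_KKT_point f g \<phi> \<psi> \<epsilon> x \<xi> lam \<longleftrightarrow>
     x \<in> feasible g \<and> conjugate \<psi> (- \<xi>) < \<infinity> \<and> 0 \<le> lam \<and>
     KKT_residual f g \<phi> \<psi> x \<xi> lam \<le> ereal \<epsilon>"

end

(* The acceptance test makes the objective F drop by alpha/2 |x^{k+1} - x^k|^2 in every iteration, so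
   among the first K+1 steps one has length at most sqrt (2 gap / (alpha (K+1))). The inexactness
   criterion and the Lipschitz gradients make the KKT residual of the triple at iteration k at most
   C |x^{k+1} - x^k|: v^{k+1} and xi^k supply explicit elements of the two partial subdifferentials of
   the Lagrangian (x^{k+1} - x^k itself is one of the second), and the complementarity defect is
   quadratic in the step.

   For the existence of the constants, strong convexity of the model bounds all trial points; beyond a
   threshold, no increase of L or mu is triggered any more; and the multipliers are bounded by the
   MFCQ, by compactness. *)

theory Submission
  imports Defs
begin

text \<open>The algorithm supplies limiting subgradients, but they are exploited as affine
  inequalities: those of the convex \<open>\<phi>\<close> are ordinary subgradients, and each one of
  the concave \<open>- \<psi>\<close> is the negative of a subgradient of \<open>\<psi>\<close>.
  Hence the conjugate of \<psi> at - \<xi>^k is finite, its supremum is attained at x^k, and x^k is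
  a subgradient of the conjugate there. This is why the triple pairs x^{k+1} with \<xi>^k, and why
  the second residual involves no Lipschitz constant.

  The bounds have to be obtained in a certain order, or they become circular. Trial steps are
  bounded from \<open>\<mu>min\<close> alone, whatever the inner loop does to L and \<mu>. Only then
  is there a compact set on which g has a uniform quadratic upper bound, which controls L. Feasible
  trial points lie in U, where the constant of \<nabla>f controls \<mu>. The multipliers come last,
  since their normalized stationarity relation needs bounds on L and Q.\<close>

section \<open>Subgradients\<close>

text \<open>Trading the quotient for an additive inequality keeps extended-real division out of
  later verifications. Finiteness is asked at \<open>x\<close> alone, so the criterion also serves
  functions that are infinite nearby, such as indicators and conjugates.\<close>

lemma regular_subdiffI:
  fixes h :: "'a::euclidean_space \<Rightarrow> ereal"
  assumes fin: "\<bar>h x\<bar> \<noteq> \<infinity>"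
    and low: "\<And>e. e > 0 \<Longrightarrow> \<forall>\<^sub>F z in at x. h x + ereal (v \<bullet> (z - x) - e * norm (z - x)) \<le> h z"
  shows "v \<in> regular_subdiff h x"
proof -
  obtain a where a: "h x = ereal a" using fin by (cases "h x") auto
  have "\<forall>\<^sub>F z in at x. c < (h z - h x - ereal (v \<bullet> (z - x))) / ereal (norm (z - x))" 
    if c: "c < 0" for c
  proof -
    obtain r where r: "c < ereal r" "r < 0"
      using ereal_dense2[OF c] by (auto simp: zero_ereal_def)
    from low[of "- r"] r(2) have "\<forall>\<^sub>F z in at x. h x + ereal (v \<bullet> (z - x) - (- r) * norm (z - x)) \<le> h z"
      by simp
    with eventually_neq_at_within[of x x UNIV] show ?thesis
    proof eventually_elim
      case (elim z)
      then have n: "norm (z - x) > 0" by simp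
      have "ereal r \<le> (h z - h x - ereal (v \<bullet> (z - x))) / ereal (norm (z - x))"
        using elim(2) n a by (cases "h z") (auto simp: field_simps)
      with r(1) show ?case by (rule less_le_trans)
    qed
  qed
  then show ?thesis using fin by (auto simp: regular_subdiff_def le_Liminf_iff)
qed

lemma regular_subdiff_imp_limiting: "v \<in> regular_subdiff h x \<Longrightarrow> v \<in> limiting_subdiff h x"
  unfolding limiting_subdiff_def
  by (intro CollectI conjI exI[of _ "\<lambda>_. x"] exI[of _ "\<lambda>_. v"])
     (auto simp: regular_subdiff_def)

lemma regular_subdiff_realD:
  fixes h :: "'a::euclidean_space \<Rightarrow> real"
  assumes v: "v \<in> regular_subdiff (\<lambda>z. ereal (h z)) x" and "e > 0"
  shows "\<forall>\<^sub>F z in at x. h x + v \<bullet> (z - x) - e * norm (z - x) \<le> h z"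
proof -
  have "ereal (- e) < 0" using \<open>e > 0\<close> by simp
  then have "\<forall>\<^sub>F z in at x. ereal (- e) < (ereal (h z) - ereal (h x) - ereal (v \<bullet> (z - x))) / ereal (norm (z - x))"
    using v unfolding regular_subdiff_def le_Liminf_iff by blast
  with eventually_neq_at_within[of x x UNIV] show ?thesis
    by eventually_elim (auto simp: field_simps)
qed

text \<open>For a convex function, one short step along a segment already controls the slope along
  all of it; hence the form with a single \<open>t\<close> below 1.\<close>

lemma regular_subdiff_direction:
  fixes h :: "'a::euclidean_space \<Rightarrow> real"
  assumes v: "v \<in> regular_subdiff (\<lambda>z. ereal (h z)) x" and "e > 0"
  shows "\<exists>t. 0 < t \<and> t < 1 \<and> h x + t * (v \<bullet> d) - e * t * norm d \<le> h (x + t *\<^sub>R d)"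
proof (cases "d = 0")
  case True
  then show ?thesis by (auto intro!: exI[of _ "1/2"])
next
  case False
  have "((\<lambda>t. x + t *\<^sub>R d) \<longlongrightarrow> x + 0 *\<^sub>R d) (at_right 0)"
    by (intro tendsto_intros)
  moreover have "\<forall>\<^sub>F t in at_right (0::real). x + t *\<^sub>R d \<noteq> x"
    using False by (auto simp: eventually_at_filter)
  ultimately have "filterlim (\<lambda>t. x + t *\<^sub>R d) (at x) (at_right 0)"
    by (auto simp: filterlim_at eventually_mono)
  with regular_subdiff_realD[OF assms]
  have "\<forall>\<^sub>F t in at_right 0. h x + v \<bullet> (x + t *\<^sub>R d - x) - e * norm (x + t *\<^sub>R d - x) \<le> h (x + t *\<^sub>R d)"
    by (rule eventually_compose_filterlim)
  moreover have "\<forall>\<^sub>F t in at_right (0::real). t < 1" "\<forall>\<^sub>F t in at_right (0::real). 0 < t"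
    by (auto simp: eventually_at_right_less order_tendstoD intro: eventually_at_rightI[of 0 1])
  ultimately have "\<forall>\<^sub>F t in at_right 0. 0 < t \<and> t < 1 \<and> h x + t * (v \<bullet> d) - e * t * norm d \<le> h (x + t *\<^sub>R d)"
    by eventually_elim (auto simp: mult.assoc)
  then show ?thesis using eventually_happens'[OF trivial_limit_at_right_real] by blast
qed

lemma le_of_le_add_small:
  fixes a b c :: real
  assumes "\<And>e. e > 0 \<Longrightarrow> a - e * c \<le> b" "c \<ge> 0"
  shows "a \<le> b"
proof (rule field_le_epsilon)
  fix e :: real assume e: "e > 0"
  have "e / (c + 1) * c \<le> e" using e assms(2) by (auto simp: field_simps)
  with assms(1)[of "e / (c + 1)"] e assms(2) show "a \<le> b + e" by auto
qed

text \<open>Convexity puts the value at the short-step point below the chord to \<open>z\<close>.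
  The common factor \<open>t\<close> cancels, and the local estimate becomes global up to an error
  proportional to \<open>e\<close>, which is arbitrary.\<close>

lemma regular_subdiff_convexD:
  fixes h :: "'a::euclidean_space \<Rightarrow> real"
  assumes h: "convex_on UNIV h" and v: "v \<in> regular_subdiff (\<lambda>z. ereal (h z)) x"
  shows "h x + v \<bullet> (z - x) \<le> h z"
proof (rule le_of_le_add_small[of _ "norm (z - x)"])
  fix e :: real assume "e > 0"
  from regular_subdiff_direction[OF v this, of "z - x"] obtain t where t: "0 < t" "t < 1"
    and le: "h x + t * (v \<bullet> (z - x)) - e * t * norm (z - x) \<le> h (x + t *\<^sub>R (z - x))" by blast
  have "h (x + t *\<^sub>R (z - x)) \<le> (1 - t) * h x + t * h z"
    using convex_onD[OF h, of t x z] t by (simp add: algebra_simps)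
  with le have "t * (v \<bullet> (z - x) - e * norm (z - x)) \<le> t * (h z - h x)" by (simp add: algebra_simps)
  with t(1) show "h x + v \<bullet> (z - x) - e * norm (z - x) \<le> h z" by simp
qed simp

text \<open>A regular subgradient of \<open>- h\<close> bounds \<open>h\<close> from above near \<open>x\<close>. Convexity along the segment
  from \<open>z\<close> through \<open>x\<close> to a point just beyond \<open>x\<close> turns this into a bound from below at \<open>z\<close>.\<close>

lemma regular_subdiff_concaveD:
  fixes h :: "'a::euclidean_space \<Rightarrow> real"
  assumes h: "convex_on UNIV h" and v: "v \<in> regular_subdiff (\<lambda>z. ereal (- h z)) x"
  shows "h x - v \<bullet> (z - x) \<le> h z"
proof (rule le_of_le_add_small[of _ "norm (z - x)"])
  fix e :: real assume "e > 0"
  from regular_subdiff_direction[OF v this, of "x - z"] obtain t where t: "0 < t" "t < 1"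
    and le: "- h x + t * (v \<bullet> (x - z)) - e * t * norm (x - z) \<le> - h (x + t *\<^sub>R (x - z))" by blast
  \<comment> \<open>Solves s (1 + t) = 1, which makes \<open>x\<close> the combination of
    \<open>z\<close> and the point beyond \<open>x\<close> with weights 1 - s and s.\<close>
  define s where "s = 1 / (1 + t)"
  have s: "0 < s" "s < 1" "s * t = 1 - s" using t by (auto simp: s_def field_simps)
  have "(1 - s) *\<^sub>R z + s *\<^sub>R (x + t *\<^sub>R (x - z)) = x"
  proof -
    have "(1 - s) *\<^sub>R z + s *\<^sub>R (x + t *\<^sub>R (x - z)) = (1 - s) *\<^sub>R z + s *\<^sub>R x + (s * t) *\<^sub>R (x - z)"
      by (simp add: algebra_simps)
    also have "\<dots> = x" unfolding s(3) by (simp add: algebra_simps)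
    finally show ?thesis .
  qed
  then have "h x \<le> (1 - s) * h z + s * h (x + t *\<^sub>R (x - z))"
    using convex_onD[OF h, of s z "x + t *\<^sub>R (x - z)"] s by simp
  also have "\<dots> \<le> (1 - s) * h z + s * (h x - t * (v \<bullet> (x - z)) + e * t * norm (x - z))"
    using le s by (intro add_left_mono mult_left_mono) auto
  also have "\<dots> = (1 - s) * h z + s * h x - (s * t) * (v \<bullet> (x - z) - e * norm (x - z))"
    by (simp add: algebra_simps)
  also have "\<dots> = (1 - s) * (h z + v \<bullet> (z - x) + e * norm (z - x)) + s * h x"
    unfolding s(3) by (simp add: algebra_simps norm_minus_commute)
  finally have "(1 - s) * h x \<le> (1 - s) * (h z + v \<bullet> (z - x) + e * norm (z - x))"
    by (simp add: algebra_simps)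
  then show "h x - v \<bullet> (z - x) - e * norm (z - x) \<le> h z" using s by simp
qed simp

lemma limiting_subdiff_convexD:
  fixes h :: "'a::euclidean_space \<Rightarrow> real"
  assumes h: "convex_on UNIV h" and v: "v \<in> limiting_subdiff (\<lambda>z. ereal (h z)) x"
  shows "h x + v \<bullet> (z - x) \<le> h z"
proof -
  obtain X V where X: "X \<longlonglongrightarrow> x" "(\<lambda>k. ereal (h (X k))) \<longlonglongrightarrow> ereal (h x)" "V \<longlonglongrightarrow> v"
    and V: "\<And>k. V k \<in> regular_subdiff (\<lambda>z. ereal (h z)) (X k)"
    using v unfolding limiting_subdiff_def by blast
  have "(\<lambda>k. h (X k) + V k \<bullet> (z - X k)) \<longlonglongrightarrow> h x + v \<bullet> (z - x)"
    using X by (intro tendsto_intros) auto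
  then show ?thesis
    using regular_subdiff_convexD[OF h V, of _ z] by (intro LIMSEQ_le_const2) auto
qed

text \<open>At a kink of \<open>h\<close> the function \<open>- h\<close> has no regular
  subgradient, so the inequality is taken at the points of the defining sequence. It is closed in
  point, value and subgradient, and survives the limit. It says that \<open>- v\<close> is a
  subgradient of \<open>h\<close>.\<close>

lemma limiting_subdiff_concaveD:
  fixes h :: "'a::euclidean_space \<Rightarrow> real"
  assumes h: "convex_on UNIV h" and v: "v \<in> limiting_subdiff (\<lambda>z. ereal (- h z)) x"
  shows "h x - v \<bullet> (z - x) \<le> h z"
proof -
  obtain X V where X: "X \<longlonglongrightarrow> x" "(\<lambda>k. ereal (- h (X k))) \<longlonglongrightarrow> ereal (- h x)" "V \<longlonglongrightarrow> v"
    and V: "\<And>k. V k \<in> regular_subdiff (\<lambda>z. ereal (- h z)) (X k)"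
    using v unfolding limiting_subdiff_def by blast
  have "(\<lambda>k. - h (X k)) \<longlonglongrightarrow> - h x" using X(2) by simp
  from tendsto_minus[OF this] have "(\<lambda>k. h (X k)) \<longlonglongrightarrow> h x" by simp
  then have "(\<lambda>k. h (X k) - V k \<bullet> (z - X k)) \<longlonglongrightarrow> h x - v \<bullet> (z - x)"
    using X by (intro tendsto_intros) auto
  then show ?thesis
    using regular_subdiff_concaveD[OF h V, of _ z] by (intro LIMSEQ_le_const2) auto
qed

text \<open>The variational inequality of convex analysis makes \<open>w\<close> a regular
  subgradient of the indicator, which is infinite off \<open>C\<close>. It serves to place the limit
  multiplier in the cone of the MFCQ.\<close>

lemma limiting_normal_coneI:
  fixes C :: "'a::euclidean_space set"
  assumes "a \<in> C" "\<And>z. z \<in> C \<Longrightarrow> w \<bullet> (z - a) \<le> 0"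
  shows "w \<in> limiting_normal_cone C a"
  unfolding limiting_normal_cone_def
proof (intro regular_subdiff_imp_limiting regular_subdiffI always_eventually allI)
  fix e :: real and z :: 'a assume "e > 0"
  have "w \<bullet> (z - a) - e * norm (z - a) \<le> 0" if "z \<in> C"
    using assms(2)[OF that] \<open>e > 0\<close> by (smt (verit) mult_nonneg_nonneg norm_ge_zero)
  then show "set_ind C a + ereal (w \<bullet> (z - a) - e * norm (z - a)) \<le> set_ind C z"
    using assms(1) by (auto simp: set_ind_def)
qed (use assms in \<open>auto simp: set_ind_def\<close>)

text \<open>Equality case of the Fenchel-Young inequality: by the subgradient inequality, the
  supremum is attained at \<open>x\<close>.\<close>

lemma conjugate_subgradient:
  assumes "\<And>z. h x + w \<bullet> (z - x) \<le> h z"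
  shows "conjugate h w = ereal (w \<bullet> x - h x)"
  unfolding conjugate_def
proof (rule antisym)
  show "(SUP z. ereal (w \<bullet> z - h z)) \<le> ereal (w \<bullet> x - h x)"
  proof (rule SUP_least)
    fix z show "ereal (w \<bullet> z - h z) \<le> ereal (w \<bullet> x - h x)"
      using assms[of z] by (simp add: inner_diff_right)
  qed
qed (auto intro: SUP_upper)

lemma conjugate_ge: "ereal (w \<bullet> z - h z) \<le> conjugate h w"
  unfolding conjugate_def by (rule SUP_upper) simp

lemma dist0_le: "v \<in> S \<Longrightarrow> norm v \<le> c \<Longrightarrow> dist0 S \<le> ereal c"
  unfolding dist0_def by (rule INF_lower2) auto

section \<open>Gradients\<close>

lemma grad_eqI: "GDERIV h x :> D \<Longrightarrow> grad h x = D"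
  unfolding grad_def
proof (rule the_equality)
  fix D' assume "GDERIV h x :> D" "GDERIV h x :> D'"
  then have "(\<lambda>d. d \<bullet> D) = (\<lambda>d. d \<bullet> D')"
    unfolding gderiv_def by (rule has_derivative_unique)
  then have "(D' - D) \<bullet> D = (D' - D) \<bullet> D'" by meson
  then have "(D' - D) \<bullet> (D' - D) = 0" by (simp add: inner_diff_right)
  then show "D' = D" by simp
qed

lemma GDERIV_grad:
  fixes h :: "'a::euclidean_space \<Rightarrow> real"
  assumes "h differentiable (at x)"
  shows "GDERIV h x :> grad h x"
proof -
  obtain h' where h': "(h has_derivative h') (at x)" using assms by (auto simp: differentiable_def)
  then interpret bounded_linear h' by (rule has_derivative_bounded_linear)
  have "h' d = d \<bullet> adjoint h' 1" for d
    using adjoint_works[of h' d 1] linear_axioms by simp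
  then have "h' = (\<lambda>d. d \<bullet> adjoint h' 1)" by (rule ext)
  with h' have "GDERIV h x :> adjoint h' 1" by (simp add: gderiv_def)
  then show ?thesis using grad_eqI by metis
qed

text \<open>Expands the adjoint in the standard basis, because the Lipschitz hypotheses concern the
  gradients of single components.\<close>

lemma jac_transp_eq_sum:
  fixes g :: "real ^ 'n \<Rightarrow> real ^ 'm"
  assumes "g differentiable (at x)"
  shows "jac_transp g x w = (\<Sum>i\<in>UNIV. w $ i *\<^sub>R grad (\<lambda>z. g z $ i) x)"
proof -
  let ?g' = "frechet_derivative g (at x)"
  have g': "(g has_derivative ?g') (at x)" using assms frechet_derivative_works by blast
  have lin: "linear ?g'" using g' has_derivative_linear by blast
  have "grad (\<lambda>z. g z $ i) x = adjoint ?g' (axis i 1)" for i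
  proof (rule grad_eqI)
    have "((\<lambda>z. g z $ i) has_derivative (\<lambda>d. ?g' d $ i)) (at x)"
      using g' by (rule bounded_linear.has_derivative[OF bounded_linear_vec_nth])
    moreover have "?g' d $ i = d \<bullet> adjoint ?g' (axis i 1)" for d
      by (simp add: adjoint_works[OF lin] inner_axis)
    ultimately show "GDERIV (\<lambda>z. g z $ i) x :> adjoint ?g' (axis i 1)"
      by (simp add: gderiv_def)
  qed
  moreover have "adjoint ?g' w = (\<Sum>i\<in>UNIV. w $ i *\<^sub>R adjoint ?g' (axis i 1))"
  proof -
    have "w = (\<Sum>i\<in>UNIV. w $ i *\<^sub>R axis i 1)"
      using basis_expansion[of w] by (simp add: scalar_mult_eq_scaleR)
    then have "adjoint ?g' w = adjoint ?g' (\<Sum>i\<in>UNIV. w $ i *\<^sub>R axis i 1)" by simp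
    also have "\<dots> = (\<Sum>i\<in>UNIV. w $ i *\<^sub>R adjoint ?g' (axis i 1))"
      using adjoint_linear[OF lin] by (simp add: linear_sum linear_cmul)
    finally show ?thesis .
  qed
  ultimately show ?thesis by (simp add: jac_transp_def)
qed

lemma descent_lemma:
  fixes h :: "'a::real_inner \<Rightarrow> real"
  assumes S: "convex S" and x: "x \<in> S" and y: "y \<in> S"
    and D: "\<And>z. z \<in> S \<Longrightarrow> GDERIV h z :> D z" and lip: "K-lipschitz_on S D"
  shows "h y \<le> h x + D x \<bullet> (y - x) + K / 2 * (norm (y - x))\<^sup>2"
proof -
  let ?d = "y - x"
  \<comment> \<open>The values of \<open>h\<close> on the segment minus the varying part of the
    claimed bound. The slope (D z - D x) . d - K t |d|^2 is nonpositive by Cauchy-Schwarz and the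
    Lipschitz condition.\<close>
  define p where "p t = h (x + t *\<^sub>R ?d) - t * (D x \<bullet> ?d) - K / 2 * t\<^sup>2 * (norm ?d)\<^sup>2" for t
  have "p 1 \<le> p 0"
  proof (rule DERIV_nonpos_imp_nonincreasing[where f = p])
    fix t :: real assume t: "0 \<le> t" "t \<le> 1"
    let ?z = "x + t *\<^sub>R ?d"
    have z: "?z \<in> S"
      using convexD_alt[OF S x y, of t] t by (simp add: algebra_simps)
    have "((\<lambda>t. h (x + t *\<^sub>R ?d)) has_derivative (\<lambda>s. (s *\<^sub>R ?d) \<bullet> D ?z)) (at t)"
      by (rule has_derivative_compose[of "\<lambda>t. x + t *\<^sub>R ?d", OF _ D[OF z, unfolded gderiv_def]])
         (auto intro!: derivative_eq_intros)
    then have "((\<lambda>t. h (x + t *\<^sub>R ?d)) has_real_derivative (D ?z \<bullet> ?d)) (at t)"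
      by (simp add: has_field_derivative_def inner_commute mult.commute[of _ "?d \<bullet> D ?z"])
    then have "(p has_real_derivative D ?z \<bullet> ?d - D x \<bullet> ?d - K * t * (norm ?d)\<^sup>2) (at t)"
      unfolding p_def by (auto intro!: derivative_eq_intros)
    moreover have "(D ?z - D x) \<bullet> ?d \<le> K * t * (norm ?d)\<^sup>2"
    proof -
      have "(D ?z - D x) \<bullet> ?d \<le> norm (D ?z - D x) * norm ?d" by (rule norm_cauchy_schwarz)
      also have "\<dots> \<le> (K * norm (?z - x)) * norm ?d"
        using lipschitz_onD[OF lip z x] by (intro mult_right_mono) (auto simp: dist_norm)
      also have "\<dots> = K * t * (norm ?d)\<^sup>2" using t by (simp add: power2_eq_square)
      finally show ?thesis .
    qed
    ultimately show "\<exists>q. (p has_real_derivative q) (at t) \<and> q \<le> 0"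
      by (auto simp: inner_diff_left)
  qed simp
  then show ?thesis by (simp add: p_def)
qed

section \<open>Quadratic forms, self-adjoint operators and weighted sums\<close>

lemma GDERIV_quadratic_form:
  fixes Q :: "'a::euclidean_space \<Rightarrow> 'a"
  assumes "linear Q" and sa: "\<And>a b. Q a \<bullet> b = a \<bullet> Q b"
  shows "GDERIV (\<lambda>z. c + b \<bullet> (z - s) + (z - s) \<bullet> Q (z - s) / 2) x :> b + Q (x - s)"
proof -
  have bl: "bounded_linear Q" using assms(1) by (simp add: linear_conv_bounded_linear)
  have "((\<lambda>z. Q (z - s)) has_derivative (\<lambda>d. Q d)) (at x)"
    by (rule bounded_linear.has_derivative[OF bl]) (auto intro!: derivative_eq_intros)
  then show ?thesis unfolding gderiv_def
    by (auto intro!: derivative_eq_intros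
        simp: fun_eq_iff inner_add_right inner_commute[of b] sa[symmetric] inner_commute[of "x - s"])
       (simp add: sa inner_commute)
qed

text \<open>Polarization: a . Q d is controlled by the form at d + a and d - a, and the
  parallelogram identity merges the two estimates. Taking \<open>a\<close> parallel to
  \<open>Q d\<close> and as long as \<open>d\<close> turns a . Q d into |d| |Q d|.\<close>

lemma selfadjoint_onorm_le:
  fixes Q :: "'a::euclidean_space \<Rightarrow> 'a"
  assumes "linear Q" and sa: "\<And>a b. Q a \<bullet> b = a \<bullet> Q b"
    and psd: "\<And>d. 0 \<le> d \<bullet> Q d" and ub: "\<And>d. d \<bullet> Q d \<le> c * (d \<bullet> d)"
  shows "norm (Q d) \<le> c * norm d"
proof (cases "Q d = 0 \<or> d = 0")
  case True
  have "0 \<le> c * (d \<bullet> d)" using psd[of d] ub[of d] by linarith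
  then have "0 \<le> c * norm d"
    by (cases "d = 0") (auto simp: zero_le_mult_iff power2_norm_eq_inner[symmetric])
  with True assms(1) show ?thesis by (auto simp: linear_0)
next
  case False
  define a where "a = (norm d / norm (Q d)) *\<^sub>R Q d"
  interpret Q: linear Q by fact
  have na: "norm a = norm d" using False by (simp add: a_def)
  have ad: "a \<bullet> Q d = norm d * norm (Q d)"
    using False by (simp add: a_def power2_norm_eq_inner[symmetric] power2_eq_square)
  have "4 * (a \<bullet> Q d) = (d + a) \<bullet> Q (d + a) - (d - a) \<bullet> Q (d - a)"
    by (simp add: Q.add Q.diff inner_add_left inner_add_right inner_diff_left inner_diff_right
        inner_commute[of d "Q a"] sa)
  also have "\<dots> \<le> c * ((d + a) \<bullet> (d + a)) + c * ((d - a) \<bullet> (d - a))"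
  proof -
    have "0 \<le> c * ((d - a) \<bullet> (d - a))" using psd[of "d - a"] ub[of "d - a"] by linarith
    then show ?thesis using ub[of "d + a"] psd[of "d - a"] by linarith
  qed
  also have "\<dots> = 2 * c * (d \<bullet> d) + 2 * c * (a \<bullet> a)"
    by (simp add: algebra_simps inner_commute[of a d])
  also have "\<dots> = 4 * c * (norm d)\<^sup>2" by (simp add: power2_norm_eq_inner[symmetric] na)
  finally have "norm d * norm (Q d) \<le> norm d * (c * norm d)" by (simp add: ad power2_eq_square mult_ac)
  with False show ?thesis by simp
qed

text \<open>Cauchy-Schwarz for the vectors of the |w_i| and the c_i. This is the source of the
  Euclidean norm in L_g.\<close>

lemma norm_sum_scaleR_le:
  fixes w c :: "real ^ 'm" and D :: "'m \<Rightarrow> 'a::real_normed_vector"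
  assumes "\<And>i. norm (D i) \<le> c $ i * t" "0 \<le> t"
  shows "norm (\<Sum>i\<in>UNIV. w $ i *\<^sub>R D i) \<le> norm w * norm c * t"
proof -
  have "norm (\<Sum>i\<in>UNIV. w $ i *\<^sub>R D i) \<le> (\<Sum>i\<in>UNIV. \<bar>w $ i\<bar> * (c $ i * t))"
    by (rule order_trans[OF norm_sum sum_mono]) (simp add: assms(1) mult_left_mono)
  also have "\<dots> = (\<Sum>i\<in>UNIV. \<bar>w $ i\<bar> * c $ i) * t" by (simp add: sum_distrib_right mult.assoc)
  also have "\<dots> = ((\<chi> i. \<bar>w $ i\<bar>) \<bullet> c) * t" by (simp add: inner_vec_def)
  also have "\<dots> \<le> (norm (\<chi> i. \<bar>w $ i\<bar>) * norm c) * t"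
    by (intro mult_right_mono norm_cauchy_schwarz assms(2))
  also have "norm (\<chi> i. \<bar>w $ i\<bar>) = norm w" by (simp add: norm_vec_def L2_set_def)
  finally show ?thesis .
qed

lemma inner_vec_mono:
  fixes w a b :: "real ^ 'm"
  assumes "0 \<le> w" "a \<le> b"
  shows "w \<bullet> a \<le> w \<bullet> b"
  unfolding inner_vec_def using assms by (intro sum_mono) (auto simp: less_eq_vec_def mult_left_mono)

section \<open>Bounds for convex functions\<close>

text \<open>Trial points are not known to be near \<open>x\<close>, so the bound must hold at any
  distance; linear decay is harmless against the quadratic term of the model.\<close>

lemma convex_on_linear_lower_bound:
  fixes h :: "'a::real_normed_vector \<Rightarrow> real"
  assumes h: "convex_on UNIV h" and B: "\<And>z. z \<in> cball x 1 \<Longrightarrow> \<bar>h z\<bar> \<le> B"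
  shows "h x - 2 * B * norm (y - x) \<le> h y"
proof (cases "y = x")
  case False
  define n where "n = norm (y - x)"
  have n: "n > 0" using False by (simp add: n_def)
  define t where "t = 1 / (n + 1)"
  have t: "0 \<le> t" "t \<le> 1" "t - (1 - t) / n = 0" using n add_pos_pos[of n "n * n"] by (auto simp: t_def field_simps)
  \<comment> \<open>\<open>x\<close> lies between \<open>y\<close> and the point \<open>u\<close> at distance 1 from \<open>x\<close> on the opposite side.\<close>
  define u where "u = x - (1 / n) *\<^sub>R (y - x)"
  have "(1 - t) *\<^sub>R u + t *\<^sub>R y = x + (t - (1 - t) / n) *\<^sub>R (y - x)"
    by (simp add: u_def algebra_simps diff_divide_distrib)
  then have "h x \<le> (1 - t) * h u + t * h y"
    using convex_onD[OF h t(1,2), of u y] unfolding t(3) by simp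
  then have "(n + 1) * h x \<le> (n + 1) * ((1 - t) * h u + t * h y)"
    using n by (intro mult_left_mono) auto
  also have "\<dots> = n * h u + h y"
  proof -
    have "(n + 1) * (1 - t) = n" "(n + 1) * t = 1" using n by (auto simp: t_def field_simps)
    then show ?thesis by (metis distrib_left mult.assoc mult_1)
  qed
  finally have "h x + n * (h x - h u) \<le> h y" by (simp add: algebra_simps)
  moreover have "- (2 * B) \<le> h x - h u"
  proof -
    have "u \<in> cball x 1" using n by (simp add: u_def dist_norm n_def)
    then show ?thesis using B[of u] B[of x] by (simp add: abs_le_iff)
  qed
  then have "n * (- (2 * B)) \<le> n * (h x - h u)" using n by (intro mult_left_mono) auto
  ultimately show ?thesis by (simp add: n_def mult_ac)
qed simp

text \<open>Tests the subgradient inequality at distance 1 in the direction of \<open>w\<close>;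
  \<open>sgn 0 = 0\<close> covers the degenerate case.\<close>

lemma subgradient_norm_le:
  fixes h :: "'a::real_inner \<Rightarrow> real"
  assumes w: "\<And>z. h x + w \<bullet> (z - x) \<le> h z" and B: "\<And>z. z \<in> cball x 1 \<Longrightarrow> \<bar>h z\<bar> \<le> B"
  shows "norm w \<le> 2 * B"
proof -
  have "x + sgn w \<in> cball x 1" by (simp add: dist_norm norm_sgn)
  then have "\<bar>h (x + sgn w)\<bar> \<le> B" "\<bar>h x\<bar> \<le> B" using B by auto
  moreover have "w \<bullet> sgn w = norm w"
    by (cases "w = 0") (auto simp: sgn_div_norm power2_norm_eq_inner[symmetric] power2_eq_square)
  then have "h x + norm w \<le> h (x + sgn w)" using w[of "x + sgn w"] by simp
  ultimately show ?thesis by linarith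
qed

text \<open>Radius 1 matches the unit balls of the two preceding bounds. Continuity of convex
  functions on a compact enlarged ball gives one constant for all centres.\<close>

lemma convex_on_bounded_near_bounded_set:
  fixes h :: "'a::euclidean_space \<Rightarrow> real"
  assumes "convex_on UNIV h" "bounded S"
  shows "\<exists>B\<ge>0. \<forall>x\<in>S. \<forall>z\<in>cball x 1. \<bar>h z\<bar> \<le> B"
proof -
  obtain \<rho> where \<rho>: "\<And>x. x \<in> S \<Longrightarrow> norm x \<le> \<rho>" using assms(2) by (auto simp: bounded_iff)
  have "continuous_on (cball 0 (\<rho> + 1)) h"
    using convex_on_continuous[OF open_UNIV assms(1)] continuous_on_subset by blast
  then have "bounded (h ` cball 0 (\<rho> + 1))"
    by (intro compact_imp_bounded compact_continuous_image) auto
  then obtain B where B: "B > 0" "\<And>z. z \<in> cball 0 (\<rho> + 1) \<Longrightarrow> \<bar>h z\<bar> \<le> B"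
    by (auto simp: bounded_pos)
  have "z \<in> cball 0 (\<rho> + 1)" if "x \<in> S" "z \<in> cball x 1" for x z
    using \<rho>[OF that(1)] that(2) norm_triangle_sub[of z x] by (auto simp: dist_norm norm_minus_commute)
  with B show ?thesis by (intro exI[of _ B]) auto
qed

section \<open>The problem data\<close>

context DC_problem
begin

abbreviation "f\<^sub>r \<equiv> \<lambda>z. real_of_ereal (f z)"

lemma mem_feasible: "z \<in> feasible g \<longleftrightarrow> g z \<le> 0"
  by (simp add: feasible_def)

lemma f_real:
  assumes "z \<in> U"
  obtains r where "f z = ereal r"
  using f_finite[OF assms] by (cases "f z") auto

lemma GDERIV_f: "z \<in> U \<Longrightarrow> GDERIV f\<^sub>r z :> grad f\<^sub>r z"
  using f_C11 by (intro GDERIV_grad) (auto simp: C11_on_def differentiable_def)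

lemma g_differentiable: "g differentiable (at z)"
  using g_C11 by (auto simp: C11_on_def differentiable_def)

lemma g_has_derivative: "(g has_derivative frechet_derivative g (at z)) (at z)"
  using g_differentiable frechet_derivative_works by blast

lemma isCont_g: "isCont g z"
  using g_has_derivative has_derivative_continuous by blast

lemma GDERIV_g: "GDERIV (\<lambda>z. g z $ i) z :> grad (\<lambda>z. g z $ i) z"
proof (rule GDERIV_grad)
  show "(\<lambda>z. g z $ i) differentiable (at z)"
    using bounded_linear.has_derivative[OF bounded_linear_vec_nth g_has_derivative]
    by (auto simp: differentiable_def)
qed

lemma frechet_derivative_g_nth:
  "frechet_derivative g (at s) d $ i = grad (\<lambda>z. g z $ i) s \<bullet> d"
proof -
  have "(\<lambda>d. frechet_derivative g (at s) d $ i) = (\<lambda>d. d \<bullet> grad (\<lambda>z. g z $ i) s)"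
    using bounded_linear.has_derivative[OF bounded_linear_vec_nth g_has_derivative[of s]]
      GDERIV_g[where z = s and i = i] unfolding gderiv_def by (rule has_derivative_unique)
  then show ?thesis by (metis inner_commute)
qed

lemma jac_transp_g: "jac_transp g z w = (\<Sum>i\<in>UNIV. w $ i *\<^sub>R grad (\<lambda>z. g z $ i) z)"
  by (rule jac_transp_eq_sum[OF g_differentiable])

lemma MBA_G_nth:
  "MBA_G g z s l $ i = g s $ i + grad (\<lambda>z. g z $ i) s \<bullet> (z - s) + (norm (z - s))\<^sup>2 / 2 * l $ i"
  by (simp add: MBA_G_def frechet_derivative_g_nth)

text \<open>The quadratic term contributes the rank-one derivative that sends d to ((z - s) . d) l;
  the linearized part keeps its derivative at \<open>s\<close>.\<close>

lemma jac_transp_MBA_G: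
  "jac_transp (\<lambda>z. MBA_G g z s l) z w = jac_transp g s w + (l \<bullet> w) *\<^sub>R (z - s)"
proof -
  let ?g' = "frechet_derivative g (at s)"
  have bl: "bounded_linear ?g'" using g_has_derivative has_derivative_bounded_linear by blast
  then have lin: "linear ?g'" by (simp add: linear_conv_bounded_linear)
  have "((\<lambda>z. ?g' (z - s)) has_derivative ?g') (at z)"
    by (rule bounded_linear.has_derivative[OF bl]) (auto intro!: derivative_eq_intros)
  then have "((\<lambda>z. MBA_G g z s l) has_derivative (\<lambda>d. ?g' d + ((z - s) \<bullet> d) *\<^sub>R l)) (at z)"
    unfolding MBA_G_def power2_norm_eq_inner
    by (auto intro!: derivative_eq_intros simp: inner_commute)
  then have "frechet_derivative (\<lambda>z. MBA_G g z s l) (at z) = (\<lambda>d. ?g' d + ((z - s) \<bullet> d) *\<^sub>R l)"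
    by (rule frechet_derivative_at[symmetric])
  moreover have "adjoint (\<lambda>d. ?g' d + ((z - s) \<bullet> d) *\<^sub>R l) = (\<lambda>w. adjoint ?g' w + (l \<bullet> w) *\<^sub>R (z - s))"
    by (rule adjoint_unique)
       (auto simp: inner_add_left inner_add_right adjoint_works[OF lin] inner_commute[of "z - s"])
  ultimately show ?thesis by (simp add: jac_transp_def)
qed

lemma objective_feasible: "z \<in> feasible g \<Longrightarrow> objective f g \<phi> \<psi> z = ereal (f\<^sub>r z + \<phi> z - \<psi> z)"
proof -
  assume z: "z \<in> feasible g"
  then obtain r where "f z = ereal r" using f_real feasible_subset by blast
  with z show ?thesis by (simp add: objective_def set_ind_def mem_feasible)
qed

lemma opt_val_real:
  obtains m where "opt_val f g \<phi> \<psi> = ereal m" "\<And>z. z \<in> feasible g \<Longrightarrow> m \<le> f\<^sub>r z + \<phi> z - \<psi> z"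
proof -
  have le: "opt_val f g \<phi> \<psi> \<le> ereal (f\<^sub>r z + \<phi> z - \<psi> z)" if "z \<in> feasible g" for z
    unfolding opt_val_def using that by (intro INF_lower2[OF that]) (simp add: objective_feasible)
  obtain z where "z \<in> feasible g" using feasible_nonempty by blast
  from le[OF this] val_bounded_below obtain m where m: "opt_val f g \<phi> \<psi> = ereal m"
    by (cases "opt_val f g \<phi> \<psi>") auto
  with le show ?thesis by (intro that[of m]) auto
qed

section \<open>Explicit subgradients of the Lagrangian\<close>

lemma Lagrangian_real:
  assumes "z \<in> U" "conjugate \<psi> (- \<zeta>) = ereal c"
  shows "Lagrangian f g \<phi> \<psi> z \<zeta> l = ereal (f\<^sub>r z + \<phi> z + z \<bullet> \<zeta> + c + l \<bullet> g z)"
proof -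
  obtain r where "f z = ereal r" using assms(1) by (rule f_real)
  then show ?thesis by (simp add: Lagrangian_def assms(2))
qed

text \<open>Sum rule: the first-order expansion of the smooth part costs e |u - z|, while the convex
  and linear parts contribute exact inequalities. Openness of \<open>U\<close> keeps
  \<open>f\<close> finite where the expansion is used.\<close>

lemma Lagrangian_subgradient_x:
  assumes z: "z \<in> U" and c: "conjugate \<psi> (- \<zeta>) = ereal c"
    and w: "\<And>u. \<phi> z + w \<bullet> (u - z) \<le> \<phi> u"
  shows "grad f\<^sub>r z + w + \<zeta> + jac_transp g z l \<in> limiting_subdiff (\<lambda>u. Lagrangian f g \<phi> \<psi> u \<zeta> l) z"
proof (intro regular_subdiff_imp_limiting regular_subdiffI)
  show "\<bar>Lagrangian f g \<phi> \<psi> z \<zeta> l\<bar> \<noteq> \<infinity>" by (simp add: Lagrangian_real[OF z c])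
next
  fix e :: real assume e: "e > 0"
  let ?h = "\<lambda>u. f\<^sub>r u + l \<bullet> g u" and ?D = "grad f\<^sub>r z + jac_transp g z l"
  have lin: "linear (frechet_derivative g (at z))" using g_has_derivative has_derivative_linear by blast
  have "((\<lambda>u. f\<^sub>r u + l \<bullet> g u) has_derivative
      (\<lambda>d. d \<bullet> grad f\<^sub>r z + l \<bullet> frechet_derivative g (at z) d)) (at z)"
    using GDERIV_f[OF z] g_has_derivative[of z] unfolding gderiv_def
    by (auto intro!: derivative_eq_intros)
  moreover have "(\<lambda>d. d \<bullet> grad f\<^sub>r z + l \<bullet> frechet_derivative g (at z) d) = (\<lambda>d. d \<bullet> ?D)"
    by (simp add: fun_eq_iff inner_add_right jac_transp_def adjoint_works[OF lin] inner_commute)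
  ultimately have D: "(?h has_derivative (\<lambda>d. d \<bullet> ?D)) (at z)" by simp
  then obtain \<delta> where "\<delta> > 0" and
    \<delta>: "\<And>u. norm (u - z) < \<delta> \<Longrightarrow> norm (?h u - ?h z - (u - z) \<bullet> ?D) \<le> e * norm (u - z)"
    using e unfolding has_derivative_at_alt by blast
  then have "\<forall>\<^sub>F u in at z. ?h z + (u - z) \<bullet> ?D - e * norm (u - z) \<le> ?h u"
    unfolding eventually_at
    by (intro exI[of _ \<delta>]) (force simp: dist_norm abs_le_iff)
  moreover have "\<forall>\<^sub>F u in at z. u \<in> U" by (rule eventually_at_in_open'[OF U_open z])
  ultimately show "\<forall>\<^sub>F u in at z. Lagrangian f g \<phi> \<psi> z \<zeta> l +
      ereal ((grad f\<^sub>r z + w + \<zeta> + jac_transp g z l) \<bullet> (u - z) - e * norm (u - z))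
      \<le> Lagrangian f g \<phi> \<psi> u \<zeta> l"
  proof eventually_elim
    case (elim u)
    have "(grad f\<^sub>r z + w + \<zeta> + jac_transp g z l) \<bullet> (u - z) =
      (u - z) \<bullet> ?D + w \<bullet> (u - z) + (u \<bullet> \<zeta> - z \<bullet> \<zeta>)"
      by (simp add: inner_add_left inner_add_right inner_diff_left inner_diff_right inner_commute)
    with elim w[of u] show ?case
      by (simp add: Lagrangian_real[OF _ c] z)
  qed
qed

text \<open>In this variable the Lagrangian is linear plus the conjugate at the negated argument,
  and \<open>s\<close> is a subgradient of the conjugate at \<open>- \<zeta>\<close> because the
  supremum there is attained at \<open>s\<close>. The inequality is global; the conjugate may be
  infinite at \<open>- u\<close>, hence the case split.\<close>

lemma Lagrangian_subgradient_\<xi>: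
  assumes z: "z \<in> U" and w: "\<And>u. \<psi> s - \<zeta> \<bullet> (u - s) \<le> \<psi> u"
  shows "z - s \<in> limiting_subdiff (\<lambda>u. Lagrangian f g \<phi> \<psi> z u l) \<zeta>"
proof (intro regular_subdiff_imp_limiting regular_subdiffI always_eventually allI)
  have c: "conjugate \<psi> (- \<zeta>) = ereal (- \<zeta> \<bullet> s - \<psi> s)"
    using w by (intro conjugate_subgradient) simp
  show "\<bar>Lagrangian f g \<phi> \<psi> z \<zeta> l\<bar> \<noteq> \<infinity>" by (simp add: Lagrangian_real[OF z c])
  fix e :: real and u assume e: "e > 0"
  have ge: "ereal (- u \<bullet> s - \<psi> s) \<le> conjugate \<psi> (- u)" by (rule conjugate_ge)
  have en: "0 \<le> e * norm (u - \<zeta>)" using e by simp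
  show "Lagrangian f g \<phi> \<psi> z \<zeta> l + ereal ((z - s) \<bullet> (u - \<zeta>) - e * norm (u - \<zeta>))
      \<le> Lagrangian f g \<phi> \<psi> z u l"
  proof (cases "conjugate \<psi> (- u)")
    case (real r)
    with ge have "- u \<bullet> s - \<psi> s \<le> r" by simp
    with en show ?thesis
      by (simp add: Lagrangian_real[OF z c] Lagrangian_real[OF z real] inner_diff_left
          inner_diff_right inner_commute)
  next
    case PInf
    moreover obtain r where "f z = ereal r" using z by (rule f_real)
    ultimately show ?thesis by (simp add: Lagrangian_def)
  next
    case MInf
    with ge show ?thesis by simp
  qed
qed

text \<open>Rejected trial points may lie outside \<open>U\<close>, so the Lipschitz hypothesis on \<open>U\<close> does not
  apply to them; the local one does, by compactness.\<close>

lemma g_quadratic_upper_bound: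
  assumes "bounded S"
  shows "\<exists>\<kappa>\<ge>0. \<forall>s\<in>S. \<forall>z\<in>S. \<forall>i.
    g z $ i \<le> g s $ i + grad (\<lambda>z. g z $ i) s \<bullet> (z - s) + \<kappa> / 2 * (norm (z - s))\<^sup>2"
proof -
  obtain h' where h': "\<And>z. (g has_derivative blinfun_apply (h' z)) (at z)"
    and loc: "\<And>z. \<exists>e>0. \<exists>K. K-lipschitz_on (ball z e) h'"
    using g_C11 by (auto simp: C11_on_def)
  obtain \<rho> where "\<forall>z\<in>S. norm z \<le> \<rho>" using assms by (auto simp: bounded_iff)
  then have \<rho>: "S \<subseteq> cball 0 \<rho>" by auto
  \<comment> \<open>The passage from local to uniform Lipschitz continuity on a compact set is
    stated for time-dependent maps; a single time is enough here.\<close>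
  have "local_lipschitz {0::real} (cball 0 \<rho>) (\<lambda>_. h')"
    unfolding local_lipschitz_def
  proof (intro ballI)
    fix z :: "real ^ 'n" and t assume "z \<in> cball 0 \<rho>" "t \<in> {0::real}"
    obtain e K where "e > 0" "K-lipschitz_on (ball z e) h'" using loc by blast
    then have "K-lipschitz_on (cball z (e/2) \<inter> cball 0 \<rho>) h'"
      by (elim lipschitz_on_subset) auto
    with \<open>e > 0\<close> show "\<exists>u>0. \<exists>L. \<forall>t\<in>cball t u \<inter> {0}. L-lipschitz_on (cball z u \<inter> cball 0 \<rho>) h'"
      by (intro exI[of _ "e/2"] conjI exI[of _ K]) auto
  qed
  from local_lipschitz_compact_implies_lipschitz[OF this]
  obtain \<kappa> where \<kappa>: "\<kappa>-lipschitz_on (cball 0 \<rho>) h'" by auto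
  have gi: "grad (\<lambda>z. g z $ i) z \<bullet> d = blinfun_apply (h' z) d $ i" for i z d
    by (simp add: frechet_derivative_g_nth[symmetric] frechet_derivative_at[OF h', symmetric])
  have "\<kappa>-lipschitz_on (cball 0 \<rho>) (grad (\<lambda>z. g z $ i))" for i
  proof (rule lipschitz_onI)
    show "0 \<le> \<kappa>" using \<kappa> by (rule lipschitz_on_nonneg)
    fix a b :: "real ^ 'n" assume ab: "a \<in> cball 0 \<rho>" "b \<in> cball 0 \<rho>"
    let ?d = "grad (\<lambda>z. g z $ i) a - grad (\<lambda>z. g z $ i) b"
    \<comment> \<open>Applying the difference of the derivatives to \<open>?d\<close> itself
      produces the square of its norm, of which one factor cancels at the end.\<close>
    have "norm ?d * norm ?d = blinfun_apply (h' a - h' b) ?d $ i"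
      by (simp add: power2_eq_square[symmetric] power2_norm_eq_inner blinfun.diff_left gi[symmetric]
          inner_diff_left)
    also have "\<dots> \<le> norm (blinfun_apply (h' a - h' b) ?d)"
      by (rule order_trans[OF abs_ge_self component_le_norm_cart])
    also have "\<dots> \<le> norm (h' a - h' b) * norm ?d" by (rule norm_blinfun)
    also have "\<dots> \<le> (\<kappa> * dist a b) * norm ?d"
      using lipschitz_onD[OF \<kappa> ab] by (intro mult_right_mono) (auto simp: dist_norm)
    finally show "dist (grad (\<lambda>z. g z $ i) a) (grad (\<lambda>z. g z $ i) b) \<le> \<kappa> * dist a b"
      by (cases "?d = 0") (auto simp: dist_norm lipschitz_on_nonneg[OF \<kappa>])
  qed
  then have "g z $ i \<le> g s $ i + grad (\<lambda>z. g z $ i) s \<bullet> (z - s) + \<kappa> / 2 * (norm (z - s))\<^sup>2"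
    if "s \<in> S" "z \<in> S" for s z i
    using that \<rho> by (intro descent_lemma[of "cball 0 \<rho>"] GDERIV_g) auto
  then show ?thesis using lipschitz_on_nonneg[OF \<kappa>] by blast
qed

end

section \<open>Descent along a run\<close>

context inexact_MBA
begin

lemma x_feasible: "x k \<in> feasible g"
  using x0 inner_stop x_update by (cases k) (auto simp: MBA_accept_def mem_feasible)

lemma x_in_U: "x k \<in> U"
  using x_feasible feasible_subset by blast

lemma psi_lower_bound: "\<psi> (x k) - \<xi> k \<bullet> (z - x k) \<le> \<psi> z"
  by (rule limiting_subdiff_concaveD[OF \<psi>_convex \<xi>])

lemma phi_lower_bound: "j \<le> jj k \<Longrightarrow> \<phi> (y k j) + v k j \<bullet> (z - y k j) \<le> \<phi> z"
  by (rule limiting_subdiff_convexD[OF \<phi>_convex v])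

lemma \<mu>_ge_\<mu>min: "j \<le> jj k \<Longrightarrow> \<mu>min \<le> \<mu> k j"
proof (induction j)
  case 0
  then show ?case using \<mu>_init[of k] by simp
next
  case (Suc j)
  then have j: "j < jj k" and IH: "\<mu>min \<le> \<mu> k j" by auto
  have "\<mu> k j \<le> \<tau> * \<mu> k j" using IH params by simp
  with IH inner_update_feasible[OF j] inner_update_infeasible[OF j] show ?case by fastforce
qed

lemma Q_norm_le: "j \<le> jj k \<Longrightarrow> norm (Q k j d) \<le> (\<mu> k j + M) * norm d"
proof (rule selfadjoint_onorm_le)
  assume j: "j \<le> jj k"
  show "0 \<le> d \<bullet> Q k j d" for d
  proof -
    have "0 \<le> \<mu> k j * (d \<bullet> d)" using \<mu>_ge_\<mu>min[OF j] params by (intro mult_nonneg_nonneg) auto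
    then show ?thesis using Q_bounds[OF j, of d] by linarith
  qed
qed (use Q_linear Q_selfadjoint Q_bounds in auto)

text \<open>The vector r of \<open>MBA_R\<close> at the trial point, written out. The gradients of f
  and g in it are those at \<open>x k\<close>, which the KKT estimate has to correct.\<close>

definition stationarity :: "nat \<Rightarrow> nat \<Rightarrow> real ^ 'n" where
  "stationarity k j = grad f\<^sub>r (x k) + \<xi> k + Q k j (y k j - x k) + v k j
     + (jac_transp g (x k) (lam k j) + (L k j \<bullet> lam k j) *\<^sub>R (y k j - x k))"

text \<open>The residual is a sum of four nonnegative terms, so each of them obeys the tolerance for
  the total.\<close>

lemma residual_bounds:
  assumes j: "j \<le> jj k"
  shows norm_stationarity_le: "norm (stationarity k j) \<le> \<beta>\<^sub>R / 2 * (norm (y k j - x k))\<^sup>2"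
    and complementarity: "- (lam k j \<bullet> MBA_G g (y k j) (x k) (L k j)) \<le> \<beta>\<^sub>R / 2 * (norm (y k j - x k))\<^sup>2"
    and infeasibility: "MBA_G g (y k j) (x k) (L k j) $ i \<le> \<beta>\<^sub>R / 2 * (norm (y k j - x k))\<^sup>2"
proof -
  let ?G = "MBA_G g (y k j) (x k) (L k j)"
  have "MBA_theta f \<psi> (x k) (\<xi> k) (Q k j) = (\<lambda>z. (f\<^sub>r (x k) - \<psi> (x k))
      + (grad f\<^sub>r (x k) + \<xi> k) \<bullet> (z - x k) + (z - x k) \<bullet> Q k j (z - x k) / 2)"
    by (simp add: MBA_theta_def fun_eq_iff)
  then have "grad (MBA_theta f \<psi> (x k) (\<xi> k) (Q k j)) (y k j) = grad f\<^sub>r (x k) + \<xi> k + Q k j (y k j - x k)"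
    using GDERIV_quadratic_form[OF Q_linear[OF j] Q_selfadjoint[OF j]] by (simp add: grad_eqI)
  then have R: "max 0 (y k j \<bullet> stationarity k j) + max 0 (- (lam k j \<bullet> ?G)) + norm (stationarity k j)
        + infnorm (\<chi> i. max 0 (?G $ i)) \<le> \<beta>\<^sub>R / 2 * (norm (y k j - x k))\<^sup>2"
    using R_bound[OF j] by (simp add: MBA_R_def Let_def jac_transp_MBA_G stationarity_def)
  have n: "0 \<le> max 0 (y k j \<bullet> stationarity k j)" "0 \<le> max 0 (- (lam k j \<bullet> ?G))" "0 \<le> norm (stationarity k j)"
    "0 \<le> infnorm (\<chi> i. max 0 (?G $ i))" "- (lam k j \<bullet> ?G) \<le> max 0 (- (lam k j \<bullet> ?G))"
    by (auto simp: infnorm_pos_le)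
  show "norm (stationarity k j) \<le> \<beta>\<^sub>R / 2 * (norm (y k j - x k))\<^sup>2"
    "- (lam k j \<bullet> ?G) \<le> \<beta>\<^sub>R / 2 * (norm (y k j - x k))\<^sup>2"
    using n R by linarith+
  have "?G $ i \<le> infnorm (\<chi> i. max 0 (?G $ i))"
    using component_le_infnorm_cart[of "\<chi> i. max 0 (?G $ i)" i] by simp
  then show "?G $ i \<le> \<beta>\<^sub>R / 2 * (norm (y k j - x k))\<^sup>2"
    using n R by linarith
qed

lemma model_diff:
  "MBA_model f \<phi> \<psi> (x k) (\<xi> k) (Q k j) z - MBA_model f \<phi> \<psi> (x k) (\<xi> k) (Q k j) (x k)
   = (grad f\<^sub>r (x k) + \<xi> k) \<bullet> (z - x k) + (z - x k) \<bullet> Q k j (z - x k) / 2 + \<phi> z - \<phi> (x k)"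
  by (simp add: MBA_model_def MBA_theta_def)

abbreviation "F \<equiv> \<lambda>z. f\<^sub>r z + \<phi> z - \<psi> z"

lemma F_decrease: "F (x (Suc k)) + \<alpha> / 2 * (norm (x (Suc k) - x k))\<^sup>2 \<le> F (x k)"
  using inner_stop[of k] objective_feasible[OF x_feasible[of k]] objective_feasible[OF x_feasible[of "Suc k"]]
  by (auto simp: MBA_accept_def x_update)

lemma sum_steps_le:
  "(\<Sum>k<n. (norm (x (Suc k) - x k))\<^sup>2) \<le> 2 * (F (x 0) - F (x n)) / \<alpha>"
proof -
  have "F (x n) + \<alpha> / 2 * (\<Sum>k<n. (norm (x (Suc k) - x k))\<^sup>2) \<le> F (x 0)"
  proof (induction n)
    case (Suc n)
    then show ?case using F_decrease[of n] by (simp add: distrib_left)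
  qed simp
  then show ?thesis using params by (simp add: field_simps)
qed

lemma steps_tendsto_0: "(\<lambda>k. x (Suc k) - x k) \<longlonglongrightarrow> 0"
proof -
  obtain m where "opt_val f g \<phi> \<psi> = ereal m" and m: "\<And>z. z \<in> feasible g \<Longrightarrow> m \<le> F z"
    using opt_val_real by blast
  have "summable (\<lambda>k. (norm (x (Suc k) - x k))\<^sup>2)"
  proof (rule bounded_imp_summable)
    fix n
    have "(\<Sum>k\<le>n. (norm (x (Suc k) - x k))\<^sup>2) \<le> 2 * (F (x 0) - F (x (Suc n))) / \<alpha>"
      using sum_steps_le[of "Suc n"] by (simp add: lessThan_Suc_atMost)
    also have "\<dots> \<le> 2 * (F (x 0) - m) / \<alpha>"
      using m[OF x_feasible[of "Suc n"]] params by (intro divide_right_mono mult_left_mono) auto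
    finally show "(\<Sum>k\<le>n. (norm (x (Suc k) - x k))\<^sup>2) \<le> 2 * (F (x 0) - m) / \<alpha>" .
  qed simp
  then have "(\<lambda>k. (norm (x (Suc k) - x k))\<^sup>2) \<longlonglongrightarrow> 0" by (rule summable_LIMSEQ_zero)
  then have "(\<lambda>k. sqrt ((norm (x (Suc k) - x k))\<^sup>2)) \<longlonglongrightarrow> sqrt 0" by (rule tendsto_real_sqrt)
  then have "(\<lambda>k. norm (x (Suc k) - x k)) \<longlonglongrightarrow> 0" by simp
  then show ?thesis by (rule tendsto_norm_zero_cancel)
qed

end

section \<open>Boundedness of the algorithmic quantities\<close>

locale Lipschitz_MBA = inexact_MBA f g \<phi> \<psi> U \<mu>min \<mu>max Lmin Lmax M \<beta>\<^sub>R \<beta>\<^sub>F \<alpha> \<tau> x \<xi> jj \<mu> L Q xbar y v lam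
  for f :: "real ^ 'n \<Rightarrow> ereal" and g :: "real ^ 'n \<Rightarrow> real ^ 'm" and \<phi> \<psi> U
    \<mu>min \<mu>max Lmin Lmax M \<beta>\<^sub>R \<beta>\<^sub>F \<alpha> \<tau> x \<xi> jj \<mu> L Q xbar y v lam +
  fixes Lf :: real and Lgs :: "real ^ 'm"
  assumes x_bounded: "bounded (range x)"
    and grad_f_lipschitz: "Lf-lipschitz_on U (grad f\<^sub>r)"
    and grad_g_lipschitz: "\<And>i. (Lgs $ i)-lipschitz_on U (grad (\<lambda>z. g z $ i))"
begin

lemma Lf_nonneg: "0 \<le> Lf"
  using grad_f_lipschitz by (rule lipschitz_on_nonneg)

lemma grad_f_bounded: "\<exists>A\<ge>0. \<forall>k. norm (grad f\<^sub>r (x k)) \<le> A"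
proof -
  obtain \<rho> where \<rho>: "\<And>k. norm (x k) \<le> \<rho>" using x_bounded by (auto simp: bounded_iff)
  have "norm (grad f\<^sub>r (x k)) \<le> norm (grad f\<^sub>r (x 0)) + Lf * (2 * \<rho>)" for k
  proof -
    have "norm (grad f\<^sub>r (x k) - grad f\<^sub>r (x 0)) \<le> Lf * norm (x k - x 0)"
      by (rule lipschitz_on_normD[OF grad_f_lipschitz x_in_U x_in_U])
    also have "\<dots> \<le> Lf * (2 * \<rho>)"
      using norm_triangle_ineq4[of "x k" "x 0"] \<rho>[of k] \<rho>[of 0] Lf_nonneg
      by (intro mult_left_mono) linarith+
    finally show ?thesis using norm_triangle_sub[of "grad f\<^sub>r (x k)" "grad f\<^sub>r (x 0)"] by linarith
  qed
  moreover have "0 \<le> norm (grad f\<^sub>r (x 0)) + Lf * (2 * \<rho>)"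
    using Lf_nonneg order_trans[OF norm_ge_zero \<rho>[of 0]] by simp
  ultimately show ?thesis by blast
qed

lemma \<xi>_bounded: "\<exists>A\<ge>0. \<forall>k. norm (\<xi> k) \<le> A"
proof -
  obtain B where B: "B \<ge> 0" "\<And>k z. z \<in> cball (x k) 1 \<Longrightarrow> \<bar>\<psi> z\<bar> \<le> B"
    using convex_on_bounded_near_bounded_set[OF \<psi>_convex x_bounded] by blast
  have "norm (- \<xi> k) \<le> 2 * B" for k
    using psi_lower_bound[of k] B(2) by (intro subgradient_norm_le[of \<psi> "x k"]) auto
  with B(1) show ?thesis by (intro exI[of _ "2 * B"]) auto
qed

lemma v_bounded: "\<exists>A\<ge>0. \<forall>k. norm (v k (jj k)) \<le> A"
proof -
  obtain B where B: "B \<ge> 0" "\<And>k z. z \<in> cball (x k) 1 \<Longrightarrow> \<bar>\<phi> z\<bar> \<le> B"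
    using convex_on_bounded_near_bounded_set[OF \<phi>_convex x_bounded] by blast
  have "norm (v k (jj k)) \<le> 2 * B" for k
    \<comment> \<open>\<open>v k (jj k)\<close> is a subgradient at the new iterate, hence the unit
      ball around \<open>x (Suc k)\<close>.\<close>
    using phi_lower_bound[of "jj k" k] B(2)[of _ "Suc k"]
    by (intro subgradient_norm_le[of \<phi> "x (Suc k)"]) (auto simp: x_update)
  with B(1) show ?thesis by (intro exI[of _ "2 * B"]) auto
qed

text \<open>The decrease test puts the quadratic term below terms linear in the step. The curvature
  is at least \<open>\<mu>min\<close> and the linear bounds are uniform over the iterates, so the
  estimate is uniform in \<open>k\<close> and \<open>j\<close>.\<close>

lemma trial_step_bounded: "\<exists>A. \<forall>k. \<forall>j\<le>jj k. norm (y k j - x k) \<le> A"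
proof -
  obtain A1 where A1: "\<And>k. norm (grad f\<^sub>r (x k)) \<le> A1" using grad_f_bounded by blast
  obtain A2 where A2: "\<And>k. norm (\<xi> k) \<le> A2" using \<xi>_bounded by blast
  obtain B where B: "B \<ge> 0" "\<And>k z. z \<in> cball (x k) 1 \<Longrightarrow> \<bar>\<phi> z\<bar> \<le> B"
    using convex_on_bounded_near_bounded_set[OF \<phi>_convex x_bounded] by blast
  have "norm (y k j - x k) \<le> 2 * (A1 + A2 + 2 * B) / \<mu>min" if j: "j \<le> jj k" for k j
  proof (cases "y k j = x k")
    case True
    have "0 \<le> A1 + A2 + 2 * B"
      using order_trans[OF norm_ge_zero A1[of k]] order_trans[OF norm_ge_zero A2[of k]] B(1) by simp
    with True params show ?thesis by simp
  next
    case False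
    let ?d = "y k j - x k"
    have "\<mu>min * (?d \<bullet> ?d) \<le> \<mu> k j * (?d \<bullet> ?d)"
      using \<mu>_ge_\<mu>min[OF j] by (intro mult_right_mono) auto
    also have "\<dots> \<le> ?d \<bullet> Q k j ?d" using Q_bounds[OF j] by blast
    also have "\<dots> \<le> 2 * (- ((grad f\<^sub>r (x k) + \<xi> k) \<bullet> ?d) + (\<phi> (x k) - \<phi> (y k j)))"
    proof -
      have "(grad f\<^sub>r (x k) + \<xi> k) \<bullet> ?d + ?d \<bullet> Q k j ?d / 2 + \<phi> (y k j) - \<phi> (x k) \<le> 0"
        using model_decrease[OF j] model_diff[of k j "y k j"] by linarith
      then show ?thesis by (simp add: field_simps)
    qed
    also have "\<dots> \<le> 2 * ((A1 + A2) * norm ?d + 2 * B * norm ?d)"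
    proof -
      have "- ((grad f\<^sub>r (x k) + \<xi> k) \<bullet> ?d) \<le> norm (grad f\<^sub>r (x k) + \<xi> k) * norm ?d"
        using Cauchy_Schwarz_ineq2[of "grad f\<^sub>r (x k) + \<xi> k" ?d] by linarith
      also have "\<dots> \<le> (A1 + A2) * norm ?d"
        using A1[of k] A2[of k] by (intro mult_right_mono norm_triangle_le) auto
      finally have "- ((grad f\<^sub>r (x k) + \<xi> k) \<bullet> ?d) \<le> (A1 + A2) * norm ?d" .
      moreover have "\<phi> (x k) - \<phi> (y k j) \<le> 2 * B * norm ?d"
        using convex_on_linear_lower_bound[OF \<phi>_convex, of "x k" B "y k j"] B(2)[of _ k] by simp
      ultimately show ?thesis by simp
    qed
    finally have "norm ?d * (\<mu>min * norm ?d) \<le> norm ?d * (2 * (A1 + A2 + 2 * B))"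
      by (simp add: power2_norm_eq_inner[symmetric] power2_eq_square algebra_simps)
    with False have "\<mu>min * norm ?d \<le> 2 * (A1 + A2 + 2 * B)" by simp
    with params show ?thesis by (simp add: field_simps)
  qed
  then show ?thesis by blast
qed

text \<open>Once every entry of \<open>L\<close> exceeds \<open>\<beta>\<^sub>R + \<kappa>\<close>, the quadratic term of the model absorbs both the
  linearization error of \<open>g\<close> and the infeasibility allowed by the residual test. All entries of \<open>L\<close> are
  scaled by the same factor, which is therefore bounded.\<close>

lemma L_bounded: "\<exists>A. \<forall>k. norm (L k (jj k)) \<le> A"
proof -
  obtain A where A: "\<And>k j. j \<le> jj k \<Longrightarrow> norm (y k j - x k) \<le> A" using trial_step_bounded by blast
  obtain \<rho> where \<rho>: "\<And>k. norm (x k) \<le> \<rho>" using x_bounded by (auto simp: bounded_iff)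
  \<comment> \<open>One ball for iterates and trial points, so that a single \<open>\<kappa>\<close>
    serves all pairs.\<close>
  define S where "S = (cball 0 (\<rho> + \<bar>A\<bar>) :: (real ^ 'n) set)"
  have xS: "x k \<in> S" for k using \<rho>[of k] by (simp add: S_def)
  have yS: "y k j \<in> S" if "j \<le> jj k" for k j
    using A[OF that] \<rho>[of k] norm_triangle_sub[of "y k j" "x k"] by (simp add: S_def)
  obtain \<kappa> where \<kappa>: "\<kappa> \<ge> 0" "\<And>s z i. s \<in> S \<Longrightarrow> z \<in> S \<Longrightarrow>
      g z $ i \<le> g s $ i + grad (\<lambda>z. g z $ i) s \<bullet> (z - s) + \<kappa> / 2 * (norm (z - s))\<^sup>2"
    using g_quadratic_upper_bound[of S] by (auto simp: S_def)
  have feas: "g (y k j) \<le> 0" if j: "j \<le> jj k" and L: "\<And>i. \<beta>\<^sub>R + \<kappa> \<le> L k j $ i" for k j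
  proof -
    have "g (y k j) $ i \<le> 0" for i
    proof -
      have "g (y k j) $ i \<le> MBA_G g (y k j) (x k) (L k j) $ i + (\<kappa> - L k j $ i) / 2 * (norm (y k j - x k))\<^sup>2"
        using \<kappa>(2)[OF xS[of k] yS[OF j], of i] by (simp add: MBA_G_nth field_simps)
      also have "\<dots> \<le> (\<beta>\<^sub>R + \<kappa> - L k j $ i) / 2 * (norm (y k j - x k))\<^sup>2"
        using infeasibility[OF j, of i] by (simp add: field_simps)
      also have "\<dots> \<le> 0" using L[of i] by (intro mult_nonpos_nonneg) auto
      finally show ?thesis .
    qed
    then show ?thesis by (simp add: less_eq_vec_def)
  qed
  \<comment> \<open>The factor grows only while some entry is below
    \<open>\<beta>\<^sub>R + \<kappa>\<close>. Initial entries are at least \<open>Lmin\<close>, so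
    it is then at most the quotient, and \<tau> accounts for the last increase. The 1 covers the
    initial factor.\<close>
  define T where "T = max 1 (\<tau> * ((\<beta>\<^sub>R + \<kappa>) / Lmin))"
  have scale: "\<exists>s. 1 \<le> s \<and> s \<le> T \<and> L k j = s *\<^sub>R L k 0" if "j \<le> jj k" for k j
    using that
  proof (induction j)
    case 0
    then show ?case by (auto simp: T_def)
  next
    case (Suc j)
    then have j: "j < jj k" "j \<le> jj k" by auto
    with Suc.IH obtain s where s: "1 \<le> s" "s \<le> T" "L k j = s *\<^sub>R L k 0" by blast
    show ?case
    proof (cases "g (y k j) \<le> 0")
      case True
      with s inner_update_feasible[OF j(1)] show ?thesis by auto
    next
      case False
      then obtain i where "\<not> \<beta>\<^sub>R + \<kappa> \<le> L k j $ i" using feas[OF j(2)] by blast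
      then have i: "L k j $ i < \<beta>\<^sub>R + \<kappa>" by simp
      have "s * Lmin \<le> s * L k 0 $ i" using L_init[of k i] s(1) by (intro mult_left_mono) auto
      with i s(3) have "s * Lmin \<le> \<beta>\<^sub>R + \<kappa>" by simp
      then have "s \<le> (\<beta>\<^sub>R + \<kappa>) / Lmin" using params by (simp add: field_simps)
      then have "\<tau> * s \<le> \<tau> * ((\<beta>\<^sub>R + \<kappa>) / Lmin)" using params by (intro mult_left_mono) auto
      then have "\<tau> * s \<le> T" by (simp add: T_def)
      moreover have "1 \<le> \<tau> * s" using params s(1) mult_mono[of 1 \<tau> 1 s] by simp
      ultimately show ?thesis using inner_update_infeasible[OF j(1) False] s(3)
        by (intro exI[of _ "\<tau> * s"]) simp
    qed
  qed
  have "norm (L k (jj k)) \<le> T * (\<Sum>i\<in>(UNIV::'m set). Lmax)" for k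
  proof -
    obtain s where s: "1 \<le> s" "s \<le> T" "L k (jj k) = s *\<^sub>R L k 0" using scale by blast
    have "norm (L k 0) \<le> (\<Sum>i\<in>(UNIV::'m set). \<bar>L k 0 $ i\<bar>)" by (rule norm_le_l1_cart)
    also have "\<dots> \<le> (\<Sum>i\<in>(UNIV::'m set). Lmax)"
    proof (rule sum_mono)
      fix i show "\<bar>L k 0 $ i\<bar> \<le> Lmax" using L_init[of k i] params by auto
    qed
    finally have "s * norm (L k 0) \<le> T * (\<Sum>i\<in>(UNIV::'m set). Lmax)"
      using s by (intro mult_mono) auto
    with s show ?thesis by simp
  qed
  then show ?thesis by blast
qed

text \<open>\<mu> grows only at a feasible rejected point, which lies in \<open>U\<close>. If \<mu>
  were at least Lf + \<alpha> there, the model decrease, the descent lemma and the affine minorant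
  of \<psi> would force acceptance. So each increase starts below Lf + \<alpha>.\<close>

lemma \<mu>_bounded: "j \<le> jj k \<Longrightarrow> \<mu> k j \<le> max \<mu>max (\<tau> * (Lf + \<alpha>))"
proof (induction j)
  case 0
  then show ?case using \<mu>_init[of k] by (simp add: max.coboundedI1)
next
  case (Suc j)
  then have j: "j < jj k" "j \<le> jj k" and IH: "\<mu> k j \<le> max \<mu>max (\<tau> * (Lf + \<alpha>))" by auto
  show ?case
  proof (cases "g (y k j) \<le> 0")
    case False
    with IH inner_update_infeasible[OF j(1)] show ?thesis by simp
  next
    case True
    let ?d = "y k j - x k"
    have "\<mu> k j < Lf + \<alpha>"
    proof (rule ccontr)
      assume "\<not> \<mu> k j < Lf + \<alpha>"
      then have "(Lf + \<alpha>) * (norm ?d)\<^sup>2 \<le> \<mu> k j * (norm ?d)\<^sup>2" by (intro mult_right_mono) auto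
      then have \<mu>: "Lf / 2 * (norm ?d)\<^sup>2 + \<alpha> / 2 * (norm ?d)\<^sup>2 \<le> \<mu> k j * (norm ?d)\<^sup>2 / 2"
        by (simp add: algebra_simps)
      have yf: "y k j \<in> feasible g" using True by (simp add: mem_feasible)
      then have yU: "y k j \<in> U" using feasible_subset by blast
      have "f\<^sub>r (y k j) \<le> f\<^sub>r (x k) + grad f\<^sub>r (x k) \<bullet> ?d + Lf / 2 * (norm ?d)\<^sup>2"
        by (rule descent_lemma[OF U_convex x_in_U yU GDERIV_f grad_f_lipschitz])
      moreover have "\<mu> k j * (norm ?d)\<^sup>2 \<le> ?d \<bullet> Q k j ?d"
        using Q_bounds[OF j(2), of ?d] by (simp add: power2_norm_eq_inner)
      moreover have "(grad f\<^sub>r (x k) + \<xi> k) \<bullet> ?d + ?d \<bullet> Q k j ?d / 2 + \<phi> (y k j) - \<phi> (x k) \<le> 0"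
        using model_decrease[OF j(2)] model_diff[of k j "y k j"] by linarith
      ultimately have "F (y k j) \<le> F (x k) - \<alpha> / 2 * (norm ?d)\<^sup>2"
        using psi_lower_bound[of k "y k j"] \<mu> unfolding inner_add_left by linarith
      then have "MBA_accept f g \<phi> \<psi> \<alpha> (x k) (y k j)"
        using True by (simp add: MBA_accept_def objective_feasible[OF yf] objective_feasible[OF x_feasible])
      with inner_continue[OF j(1)] show False by simp
    qed
    then have "\<tau> * \<mu> k j \<le> \<tau> * (Lf + \<alpha>)" using params by simp
    with inner_update_feasible[OF j(1) True] show ?thesis by (simp add: max.coboundedI2)
  qed
qed

lemma Q_bounded: "\<exists>A. \<forall>k. onorm (Q k (jj k)) \<le> A"
proof (intro exI allI)
  fix k
  show "onorm (Q k (jj k)) \<le> max \<mu>max (\<tau> * (Lf + \<alpha>)) + M"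
  proof (rule onorm_bound)
    show "norm (Q k (jj k) d) \<le> (max \<mu>max (\<tau> * (Lf + \<alpha>)) + M) * norm d" for d
      by (rule order_trans[OF Q_norm_le]) (auto intro!: mult_right_mono \<mu>_bounded)
  qed (use params in auto)
qed

lemma norm_Q_le_onorm: "norm (Q k (jj k) d) \<le> onorm (Q k (jj k)) * norm d"
  using Q_linear[of "jj k" k] by (intro onorm) (simp add: linear_conv_bounded_linear)

section \<open>Boundedness of the multipliers\<close>

lemma inner_MBA_G:
  "w \<bullet> MBA_G g z s l = w \<bullet> g s + (z - s) \<bullet> jac_transp g s w + (norm (z - s))\<^sup>2 / 2 * (l \<bullet> w)"
proof -
  have "linear (frechet_derivative g (at s))" using g_has_derivative has_derivative_linear by blast
  then show ?thesis
    by (simp add: MBA_G_def jac_transp_def inner_add_right adjoint_works inner_commute)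
qed

lemma jac_transp_g_tendsto:
  assumes X: "X \<longlonglongrightarrow> a" and a: "a \<in> U" and W: "W \<longlonglongrightarrow> w"
  shows "(\<lambda>n. jac_transp g (X n) (W n)) \<longlonglongrightarrow> jac_transp g a w"
proof -
  have "isCont (grad (\<lambda>z. g z $ i)) a" for i
    using lipschitz_on_continuous_on[OF grad_g_lipschitz] a U_open continuous_on_eq_continuous_at by blast
  then have "(\<lambda>n. grad (\<lambda>z. g z $ i) (X n)) \<longlonglongrightarrow> grad (\<lambda>z. g z $ i) a" for i
    using X by (rule isCont_tendsto_compose)
  then show ?thesis
    unfolding jac_transp_g by (intro tendsto_sum tendsto_scaleR tendsto_vec_nth W) auto
qed


text \<open>If the multipliers were unbounded, a limit of normalized multipliers would be a nonzero normal
  vector in the kernel of \<open>\<nabla>g\<close> at a cluster point, since the steps tend to zero. This contradicts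
  the MFCQ.\<close>

lemma lam_bounded:
  assumes MFCQ: "\<forall>z\<in>feasible g. MFCQ_at g z"
  shows "\<exists>A. \<forall>k. norm (lam k (jj k)) \<le> A"
proof (rule ccontr)
  define \<Lambda> where "\<Lambda> k = lam k (jj k)" for k
  define d where "d k = x (Suc k) - x k" for k
  assume "\<nexists>A. \<forall>k. norm (lam k (jj k)) \<le> A"
  then have "\<not> Bseq \<Lambda>" by (auto simp: Bseq_def \<Lambda>_def)
  then have "\<not> (\<forall>\<^sub>F k in sequentially. norm (\<Lambda> k) \<le> c)" if "c > 0" for c
    using that unfolding Bfun_def by blast
  then have "\<exists>k\<ge>n. real (Suc n) \<le> norm (\<Lambda> k)" for n
    by (fastforce simp: eventually_sequentially not_le dest!: spec[of _ "real (Suc n)"])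
  then obtain K where K: "\<And>n. n \<le> K n" "\<And>n. real (Suc n) \<le> norm (\<Lambda> (K n))" by metis
  \<comment> \<open>Iterate and direction are compactified as a pair, so one subsequence serves
    both.\<close>
  have "bounded (range (\<lambda>n. (x (K n), sgn (\<Lambda> (K n)))))"
  proof (rule bounded_subset)
    show "bounded (range x \<times> cball (0 :: real ^ 'm) 1)" using x_bounded by (intro bounded_Times) auto
  qed (auto simp: norm_sgn)
  from bounded_imp_convergent_subsequence[OF this] obtain l \<rho> where \<rho>: "strict_mono \<rho>"
    and "((\<lambda>n. (x (K n), sgn (\<Lambda> (K n)))) \<circ> \<rho>) \<longlonglongrightarrow> l" by blast
  moreover obtain a w where "l = (a, w)" by (cases l)
  ultimately have lim: "((\<lambda>n. (x (K n), sgn (\<Lambda> (K n)))) \<circ> \<rho>) \<longlonglongrightarrow> (a, w)" by simp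
  define \<kappa> where "\<kappa> n = K (\<rho> n)" for n
  define X where "X n = x (\<kappa> n)" for n
  define W where "W n = sgn (\<Lambda> (\<kappa> n))" for n
  have X: "X \<longlonglongrightarrow> a" and W: "W \<longlonglongrightarrow> w"
    using tendsto_fst[OF lim] tendsto_snd[OF lim] by (simp_all add: X_def[abs_def] W_def[abs_def] \<kappa>_def o_def)
  have \<kappa>: "n \<le> \<kappa> n" "real (Suc n) \<le> norm (\<Lambda> (\<kappa> n))" for n
    using K[of "\<rho> n"] seq_suble[OF \<rho>, of n] by (auto simp: \<kappa>_def)
  have \<Lambda>_pos: "0 < norm (\<Lambda> (\<kappa> n))" for n using \<kappa>(2)[of n] by linarith
  then have \<Lambda>_eq: "\<Lambda> (\<kappa> n) = norm (\<Lambda> (\<kappa> n)) *\<^sub>R W n" for n by (simp add: W_def sgn_div_norm)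
  have normW: "norm (W n) = 1" for n using \<Lambda>_pos[of n] by (simp add: W_def norm_sgn)
  have \<Lambda>_nonneg: "0 \<le> \<Lambda> k" for k using lam_nonneg by (simp add: \<Lambda>_def)
  have W_nonneg: "0 \<le> W n" for n
    using \<Lambda>_nonneg[of "\<kappa> n"] by (simp add: W_def sgn_div_norm less_eq_vec_def)
  \<comment> \<open>\<open>\<kappa>\<close> need not be monotone; n \<le> \<kappa> n already carries
    the vanishing of the steps over to the chosen indices.\<close>
  have "filterlim \<kappa> at_top sequentially"
    using \<kappa>(1) by (intro filterlim_at_top_mono[OF filterlim_ident]) auto
  then have d0: "(\<lambda>n. d (\<kappa> n)) \<longlonglongrightarrow> 0"
    using filterlim_compose[OF steps_tendsto_0] by (simp add: d_def)

  obtain AL where AL: "\<And>k. norm (L k (jj k)) \<le> AL" using L_bounded by blast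
  have LW: "\<bar>L k (jj k) \<bullet> W n\<bar> \<le> AL" for k n
    using Cauchy_Schwarz_ineq2[of "L k (jj k)" "W n"] AL[of k] by (simp add: normW)
  obtain A1 where A1: "\<And>k. norm (grad f\<^sub>r (x k)) \<le> A1" using grad_f_bounded by blast
  obtain A2 where A2: "\<And>k. norm (\<xi> k) \<le> A2" using \<xi>_bounded by blast
  obtain A3 where A3: "\<And>k. norm (v k (jj k)) \<le> A3" using v_bounded by blast
  obtain A4 where A4: "\<And>k. onorm (Q k (jj k)) \<le> A4" using Q_bounded by blast
  obtain D where D: "\<And>k. norm (d k) \<le> D" using trial_step_bounded by (metis d_def order_refl x_update)
  \<comment> \<open>Bounds all of the stationarity relation but its multiplier terms; division by
    the multiplier norm, at least n + 1, sends this part to 0.\<close>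
  define C where "C = A1 + A2 + A4 * D + A3 + \<beta>\<^sub>R / 2 * D\<^sup>2"
  have C: "norm (stationarity k (jj k) - (grad f\<^sub>r (x k) + \<xi> k + Q k (jj k) (d k) + v k (jj k))) \<le> C" for k
  proof -
    have "norm (stationarity k (jj k)) \<le> \<beta>\<^sub>R / 2 * (norm (d k))\<^sup>2"
      using norm_stationarity_le[of "jj k" k] by (simp add: d_def x_update)
    also have "\<dots> \<le> \<beta>\<^sub>R / 2 * D\<^sup>2"
      using params D[of k] by (intro mult_left_mono power_mono) auto
    finally have "norm (stationarity k (jj k)) \<le> \<beta>\<^sub>R / 2 * D\<^sup>2" .
    moreover have "norm (Q k (jj k) (d k)) \<le> A4 * D"
    proof (rule order_trans[OF norm_Q_le_onorm mult_mono])
      have "bounded_linear (Q k (jj k))" using Q_linear[of "jj k" k] by (simp add: linear_conv_bounded_linear)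
      then show "0 \<le> A4" using A4[of k] onorm_pos_le[of "Q k (jj k)"] by linarith
    qed (use A4 D in auto)
    ultimately show ?thesis
      using A1[of k] A2[of k] A3[of k] unfolding C_def
      by (intro norm_triangle_le_diff) (smt (verit) norm_triangle_ineq)
  qed
  have jac_eq: "jac_transp g (X n) (W n) = (1 / norm (\<Lambda> (\<kappa> n))) *\<^sub>R
      (stationarity (\<kappa> n) (jj (\<kappa> n)) - (grad f\<^sub>r (X n) + \<xi> (\<kappa> n) + Q (\<kappa> n) (jj (\<kappa> n)) (d (\<kappa> n)) + v (\<kappa> n) (jj (\<kappa> n))))
      - (L (\<kappa> n) (jj (\<kappa> n)) \<bullet> W n) *\<^sub>R d (\<kappa> n)" (is "_ = _ *\<^sub>R ?e - _") for n
  proof -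
    let ?k = "\<kappa> n" and ?t = "norm (\<Lambda> (\<kappa> n))"
    have "?e = jac_transp g (X n) (\<Lambda> ?k) + (L ?k (jj ?k) \<bullet> \<Lambda> ?k) *\<^sub>R d ?k"
      by (simp add: stationarity_def X_def d_def \<Lambda>_def x_update)
    also have "\<dots> = jac_transp g (X n) (?t *\<^sub>R W n) + (L ?k (jj ?k) \<bullet> (?t *\<^sub>R W n)) *\<^sub>R d ?k"
      using \<Lambda>_eq[of n] by simp
    also have "\<dots> = ?t *\<^sub>R (jac_transp g (X n) (W n) + (L ?k (jj ?k) \<bullet> W n) *\<^sub>R d ?k)"
      by (simp add: jac_transp_g scaleR_sum_right scaleR_add_right)
    finally show ?thesis using \<Lambda>_pos[of n] by simp
  qed
  have "(\<lambda>n. jac_transp g (X n) (W n)) \<longlonglongrightarrow> 0"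
  proof (rule Lim_null_comparison)
    have "norm (jac_transp g (X n) (W n)) \<le> C * inverse (real (Suc n)) + AL * norm (d (\<kappa> n))" for n
    proof -
      have "norm (jac_transp g (X n) (W n)) \<le> 1 / norm (\<Lambda> (\<kappa> n)) * C + AL * norm (d (\<kappa> n))"
        unfolding jac_eq using C[of "\<kappa> n"] LW[of "\<kappa> n" n]
        by (intro norm_triangle_le_diff add_mono) (auto simp: X_def mult_right_mono divide_right_mono)
      also have "1 / norm (\<Lambda> (\<kappa> n)) * C \<le> inverse (real (Suc n)) * C"
      proof (intro mult_right_mono)
        show "1 / norm (\<Lambda> (\<kappa> n)) \<le> inverse (real (Suc n))"
          using \<kappa>(2)[of n] by (simp add: inverse_eq_divide frac_le)
        show "0 \<le> C" using order_trans[OF norm_ge_zero C] .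
      qed
      finally show ?thesis by (simp add: mult.commute)
    qed
    then show "\<forall>\<^sub>F n in sequentially. norm (jac_transp g (X n) (W n)) \<le>
        C * inverse (real (Suc n)) + AL * norm (d (\<kappa> n))" by simp
    have "(\<lambda>n. C * inverse (real (Suc n)) + AL * norm (d (\<kappa> n))) \<longlonglongrightarrow> C * 0 + AL * norm (0 :: real ^ 'n)"
      by (intro tendsto_add tendsto_mult tendsto_const LIMSEQ_inverse_real_of_nat tendsto_norm d0)
    then show "(\<lambda>n. C * inverse (real (Suc n)) + AL * norm (d (\<kappa> n))) \<longlonglongrightarrow> 0" by simp
  qed
  note jac0 = this

  have ga: "(\<lambda>n. g (X n)) \<longlonglongrightarrow> g a" using isCont_g X by (rule isCont_tendsto_compose)
  have "g a \<le> 0"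
    unfolding less_eq_vec_def
  proof
    fix i
    have "g (X n) $ i \<le> 0" for n using x_feasible[of "\<kappa> n"] by (simp add: X_def mem_feasible less_eq_vec_def)
    then show "g a $ i \<le> 0 $ i" using tendsto_vec_nth[OF ga, of i] by (simp add: LIMSEQ_le_const2)
  qed
  then have a: "a \<in> feasible g" by (simp add: mem_feasible)
  then have "a \<in> U" using feasible_subset by blast
  from jac_transp_g_tendsto[OF X this W] jac0 have ker: "jac_transp g a w = 0"
    by (rule LIMSEQ_unique)
  have w: "0 \<le> w"
    unfolding less_eq_vec_def
  proof
    fix i
    show "0 $ i \<le> w $ i" using tendsto_vec_nth[OF W, of i] W_nonneg
      by (intro LIMSEQ_le_const[of "\<lambda>n. W n $ i"]) (auto simp: less_eq_vec_def)
  qed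
  have "- (w \<bullet> g a) \<le> 0"
  proof (rule LIMSEQ_le)
    show "(\<lambda>n. - (W n \<bullet> g (X n))) \<longlonglongrightarrow> - (w \<bullet> g a)" by (intro tendsto_intros W ga)
    have "(\<lambda>n. \<beta>\<^sub>R / 2 * (norm (d (\<kappa> n)))\<^sup>2 + d (\<kappa> n) \<bullet> jac_transp g (X n) (W n) + (norm (d (\<kappa> n)))\<^sup>2 / 2 * AL)
      \<longlonglongrightarrow> \<beta>\<^sub>R / 2 * (norm (0 :: real ^ 'n))\<^sup>2 + 0 \<bullet> (0 :: real ^ 'n) + (norm (0 :: real ^ 'n))\<^sup>2 / 2 * AL"
      by (intro tendsto_intros d0 jac0) simp
    then show "(\<lambda>n. \<beta>\<^sub>R / 2 * (norm (d (\<kappa> n)))\<^sup>2 + d (\<kappa> n) \<bullet> jac_transp g (X n) (W n) + (norm (d (\<kappa> n)))\<^sup>2 / 2 * AL)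
      \<longlonglongrightarrow> 0" by simp
    have "- (W n \<bullet> g (X n)) \<le> \<beta>\<^sub>R / 2 * (norm (d (\<kappa> n)))\<^sup>2 + d (\<kappa> n) \<bullet> jac_transp g (X n) (W n)
        + (norm (d (\<kappa> n)))\<^sup>2 / 2 * AL" for n
    proof -
      let ?k = "\<kappa> n" and ?t = "norm (\<Lambda> (\<kappa> n))"
      let ?G = "MBA_G g (x (Suc ?k)) (X n) (L ?k (jj ?k))"
      have "- (\<Lambda> ?k \<bullet> ?G) \<le> \<beta>\<^sub>R / 2 * (norm (d ?k))\<^sup>2"
        using complementarity[of "jj ?k" ?k] by (simp add: d_def x_update X_def \<Lambda>_def)
      moreover have "\<Lambda> ?k \<bullet> ?G = ?t * (W n \<bullet> ?G)"
        using arg_cong[OF \<Lambda>_eq[of n], of "\<lambda>u. u \<bullet> ?G"] by simp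
      ultimately have "?t * (- (W n \<bullet> ?G)) \<le> \<beta>\<^sub>R / 2 * (norm (d ?k))\<^sup>2" by simp
      \<comment> \<open>As \<open>?t\<close> is at least 1, the tolerance may be enlarged by this
        factor, which then cancels.\<close>
      also have "\<dots> \<le> ?t * (\<beta>\<^sub>R / 2 * (norm (d ?k))\<^sup>2)"
        using mult_right_mono[of 1 ?t "\<beta>\<^sub>R / 2 * (norm (d ?k))\<^sup>2"] \<kappa>(2)[of n] params by simp
      finally have "- (W n \<bullet> ?G) \<le> \<beta>\<^sub>R / 2 * (norm (d ?k))\<^sup>2"
        using \<Lambda>_pos[of n] by (rule mult_left_le_imp_le)
      moreover have "W n \<bullet> ?G = W n \<bullet> g (X n) + d ?k \<bullet> jac_transp g (X n) (W n)
          + (norm (d ?k))\<^sup>2 / 2 * (L ?k (jj ?k) \<bullet> W n)"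
        unfolding inner_MBA_G by (simp add: d_def X_def)
      moreover have "(norm (d ?k))\<^sup>2 / 2 * (L ?k (jj ?k) \<bullet> W n) \<le> (norm (d ?k))\<^sup>2 / 2 * AL"
        using LW[of ?k n] by (intro mult_left_mono) auto
      ultimately show ?thesis by linarith
    qed
    then show "\<exists>N. \<forall>n\<ge>N. - (W n \<bullet> g (X n)) \<le> \<beta>\<^sub>R / 2 * (norm (d (\<kappa> n)))\<^sup>2
        + d (\<kappa> n) \<bullet> jac_transp g (X n) (W n) + (norm (d (\<kappa> n)))\<^sup>2 / 2 * AL" by blast
  qed
  \<comment> \<open>For the orthant, w \<ge> 0 gives w . z \<le> 0 for all z \<le> 0; with w . g a
    \<ge> 0 this is the normality inequality at g a.\<close>
  then have "w \<in> limiting_normal_cone {..0} (g a)"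
  proof (intro limiting_normal_coneI)
    fix z :: "real ^ 'm" assume "- (w \<bullet> g a) \<le> 0" "z \<in> {..0}"
    then show "w \<bullet> (z - g a) \<le> 0" using inner_vec_mono[OF w, of z 0] by (simp add: inner_diff_right)
  qed (use \<open>g a \<le> 0\<close> in auto)
  with ker MFCQ a have "w = 0" unfolding MFCQ_at_def by blast
  moreover have "norm w = 1"
    using tendsto_norm[OF W] by (simp add: normW LIMSEQ_const_iff)
  ultimately show False by simp
qed

lemma iterate_bounds_exist:
  assumes "\<forall>z\<in>feasible g. MFCQ_at g z"
  shows "\<exists>c\<^sub>R \<beta>\<^sub>l \<beta>\<^sub>L \<beta>\<^sub>Q. MBA_iterate_bounds \<beta>\<^sub>R x (\<lambda>k. lam k (jj k)) (\<lambda>k. L k (jj k))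
    (\<lambda>k. Q k (jj k)) c\<^sub>R \<beta>\<^sub>l \<beta>\<^sub>L \<beta>\<^sub>Q"
proof -
  obtain A where "\<forall>k. \<forall>j\<le>jj k. norm (y k j - x k) \<le> A" using trial_step_bounded by blast
  then have "\<forall>k. norm (x (Suc k) - x k) \<le> A" by (simp add: x_update)
  \<comment> \<open>The maximum with 1 secures the strict positivity demanded of the
    constants.\<close>
  then have "\<forall>k. \<beta>\<^sub>R / 2 * norm (x (Suc k) - x k) \<le> max 1 (\<beta>\<^sub>R / 2 * A)"
    using params by (simp add: le_max_iff_disj)
  moreover obtain B where "\<forall>k. norm (lam k (jj k)) \<le> B" using lam_bounded[OF assms] by blast
  then have "\<forall>k. norm (lam k (jj k)) \<le> max 1 B" by (simp add: le_max_iff_disj)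
  moreover obtain C where "\<forall>k. norm (L k (jj k)) \<le> C" using L_bounded by blast
  then have "\<forall>k. norm (L k (jj k)) \<le> max 1 C" by (simp add: le_max_iff_disj)
  moreover obtain D where "\<forall>k. onorm (Q k (jj k)) \<le> D" using Q_bounded by blast
  then have "\<forall>k. onorm (Q k (jj k)) \<le> max 1 D" by (simp add: le_max_iff_disj)
  ultimately show ?thesis
    unfolding MBA_iterate_bounds_def
    by (intro exI[of _ "max 1 (\<beta>\<^sub>R / 2 * A)"] exI[of _ "max 1 B"] exI[of _ "max 1 C"] exI[of _ "max 1 D"]) auto
qed

section \<open>The KKT residual of an iterate\<close>

text \<open>Moving the gradients from \<open>x k\<close> to \<open>x (Suc k)\<close> costs Lf and
  L_g; the Q and L terms of the model are subtracted. Splitting one factor |d| off the quadratic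
  tolerance leaves the quantity that c_R bounds.\<close>

lemma Lagrangian_x_residual:
  "norm (grad f\<^sub>r (x (Suc k)) + v k (jj k) + \<xi> k + jac_transp g (x (Suc k)) (lam k (jj k)))
   \<le> (Lf + \<beta>\<^sub>R / 2 * norm (x (Suc k) - x k) + onorm (Q k (jj k))
      + norm (lam k (jj k)) * (norm Lgs + norm (L k (jj k)))) * norm (x (Suc k) - x k)"
proof -
  let ?j = "jj k" let ?d = "x (Suc k) - x k" and ?l = "lam k (jj k)"
  have y: "y k ?j = x (Suc k)" by (simp add: x_update)
  have eq: "grad f\<^sub>r (x (Suc k)) + v k ?j + \<xi> k + jac_transp g (x (Suc k)) ?l
      = stationarity k ?j + (grad f\<^sub>r (x (Suc k)) - grad f\<^sub>r (x k)) - Q k ?j ?d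
        + (jac_transp g (x (Suc k)) ?l - jac_transp g (x k) ?l) - (L k ?j \<bullet> ?l) *\<^sub>R ?d"
    by (simp add: stationarity_def y)
  have "norm (grad f\<^sub>r (x (Suc k)) + v k ?j + \<xi> k + jac_transp g (x (Suc k)) ?l) \<le> norm (stationarity k ?j) + norm (grad f\<^sub>r (x (Suc k)) - grad f\<^sub>r (x k)) + norm (Q k ?j ?d)
        + norm (jac_transp g (x (Suc k)) ?l - jac_transp g (x k) ?l) + norm ((L k ?j \<bullet> ?l) *\<^sub>R ?d)"
    unfolding eq by (intro norm_triangle_le norm_triangle_le_diff add_right_mono order_refl)
  also have "\<dots> \<le> \<beta>\<^sub>R / 2 * norm ?d * norm ?d + Lf * norm ?d + onorm (Q k ?j) * norm ?d
        + norm ?l * norm Lgs * norm ?d + norm ?l * norm (L k ?j) * norm ?d"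
  proof (intro add_mono)
    show "norm (stationarity k ?j) \<le> \<beta>\<^sub>R / 2 * norm ?d * norm ?d"
      using norm_stationarity_le[of ?j k] by (simp add: y power2_eq_square)
    show "norm (grad f\<^sub>r (x (Suc k)) - grad f\<^sub>r (x k)) \<le> Lf * norm ?d"
      by (rule lipschitz_on_normD[OF grad_f_lipschitz x_in_U x_in_U])
    show "norm (Q k ?j ?d) \<le> onorm (Q k ?j) * norm ?d" by (rule norm_Q_le_onorm)
    show "norm (jac_transp g (x (Suc k)) ?l - jac_transp g (x k) ?l) \<le> norm ?l * norm Lgs * norm ?d"
      unfolding jac_transp_g sum_subtractf[symmetric] scaleR_diff_right[symmetric]
      by (intro norm_sum_scaleR_le lipschitz_on_normD[OF grad_g_lipschitz x_in_U x_in_U]) simp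
    show "norm ((L k ?j \<bullet> ?l) *\<^sub>R ?d) \<le> norm ?l * norm (L k ?j) * norm ?d"
      using Cauchy_Schwarz_ineq2[of "L k ?j" ?l] by (simp add: mult_right_mono mult.commute[of "norm ?l"])
  qed
  also have "\<dots> = (Lf + \<beta>\<^sub>R / 2 * norm ?d + onorm (Q k ?j) + norm ?l * (norm Lgs + norm (L k ?j))) * norm ?d"
    by (simp add: algebra_simps)
  finally show ?thesis .
qed

text \<open>The descent lemma for each - g_i bounds - g at the new point by - G plus a quadratic
  error. Pairing with the nonnegative multiplier preserves this, and the tolerance handles the model
  term.\<close>

lemma complementarity_residual:
  "- (g (x (Suc k)) \<bullet> lam k (jj k))
   \<le> (norm (lam k (jj k)) * (norm Lgs + norm (L k (jj k))) + \<beta>\<^sub>R) / 2 * (norm (x (Suc k) - x k))\<^sup>2"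
proof -
  let ?l = "lam k (jj k)" and ?L = "L k (jj k)" and ?d = "x (Suc k) - x k"
  let ?G = "MBA_G g (x (Suc k)) (x k) ?L"
  have "- g (x (Suc k)) \<le> - ?G + ((norm ?d)\<^sup>2 / 2) *\<^sub>R (Lgs + ?L)"
    unfolding less_eq_vec_def
  proof
    fix i
    have "- g (x (Suc k)) $ i \<le> - g (x k) $ i + - grad (\<lambda>z. g z $ i) (x k) \<bullet> ?d + Lgs $ i / 2 * (norm ?d)\<^sup>2"
      using grad_g_lipschitz[of i]
      by (intro descent_lemma[of U, where h = "\<lambda>z. - g z $ i" and D = "\<lambda>z. - grad (\<lambda>z. g z $ i) z"]
          U_convex x_in_U GDERIV_minus GDERIV_g) simp
    then show "(- g (x (Suc k))) $ i \<le> (- ?G + ((norm ?d)\<^sup>2 / 2) *\<^sub>R (Lgs + ?L)) $ i"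
      by (simp add: MBA_G_nth field_simps)
  qed
  then have "?l \<bullet> (- g (x (Suc k))) \<le> ?l \<bullet> (- ?G + ((norm ?d)\<^sup>2 / 2) *\<^sub>R (Lgs + ?L))"
    using lam_nonneg[of "jj k" k] by (intro inner_vec_mono) auto
  also have "\<dots> = - (?l \<bullet> ?G) + (?l \<bullet> (Lgs + ?L)) * ((norm ?d)\<^sup>2 / 2)"
    by (simp add: inner_add_right inner_diff_right)
  also have "\<dots> \<le> \<beta>\<^sub>R / 2 * (norm ?d)\<^sup>2 + (norm ?l * (norm Lgs + norm ?L)) * ((norm ?d)\<^sup>2 / 2)"
  proof (intro add_mono mult_right_mono)
    show "- (?l \<bullet> ?G) \<le> \<beta>\<^sub>R / 2 * (norm ?d)\<^sup>2"
      using complementarity[of "jj k" k] by (simp add: x_update)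
    show "?l \<bullet> (Lgs + ?L) \<le> norm ?l * (norm Lgs + norm ?L)"
      by (rule order_trans[OF norm_cauchy_schwarz mult_left_mono[OF norm_triangle_ineq]]) simp
  qed simp
  finally show ?thesis by (simp add: inner_commute field_simps)
qed

lemma conjugate_psi: "conjugate \<psi> (- \<xi> k) = ereal (- \<xi> k \<bullet> x k - \<psi> (x k))"
  using psi_lower_bound by (intro conjugate_subgradient) simp

text \<open>One entry of C per residual: the first collects the stationarity errors, the 1 is there
  because the second subgradient is the step itself, and the root appears because the
  complementarity defect is quadratic.\<close>

lemma KKT_residual_le:
  assumes bds: "MBA_iterate_bounds \<beta>\<^sub>R x (\<lambda>k. lam k (jj k)) (\<lambda>k. L k (jj k))
      (\<lambda>k. Q k (jj k)) c\<^sub>R \<beta>\<^sub>l \<beta>\<^sub>L \<beta>\<^sub>Q"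
    and C: "Lf + c\<^sub>R + \<beta>\<^sub>Q + \<beta>\<^sub>l * (norm Lgs + \<beta>\<^sub>L) \<le> C" "1 \<le> C"
      "sqrt ((\<beta>\<^sub>l * (norm Lgs + \<beta>\<^sub>L) + \<beta>\<^sub>R) / 2) \<le> C"
  shows "KKT_residual f g \<phi> \<psi> (x (Suc k)) (\<xi> k) (lam k (jj k)) \<le> ereal (C * norm (x (Suc k) - x k))"
proof -
  let ?d = "x (Suc k) - x k" and ?l = "lam k (jj k)"
  have b: "0 < \<beta>\<^sub>l" "\<beta>\<^sub>R / 2 * norm ?d \<le> c\<^sub>R" "norm ?l \<le> \<beta>\<^sub>l" "norm (L k (jj k)) \<le> \<beta>\<^sub>L" "onorm (Q k (jj k)) \<le> \<beta>\<^sub>Q"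
    using bds by (auto simp: MBA_iterate_bounds_def)
  have lL: "norm ?l * (norm Lgs + norm (L k (jj k))) \<le> \<beta>\<^sub>l * (norm Lgs + \<beta>\<^sub>L)"
    using b by (intro mult_mono add_left_mono) auto
  have "norm (grad f\<^sub>r (x (Suc k)) + v k (jj k) + \<xi> k + jac_transp g (x (Suc k)) ?l) \<le> C * norm ?d"
    using lL b C(1) by (intro order_trans[OF Lagrangian_x_residual mult_right_mono]) auto
  moreover have "\<phi> (x (Suc k)) + v k (jj k) \<bullet> (z - x (Suc k)) \<le> \<phi> z" for z
    using phi_lower_bound[of "jj k" k z] by (simp add: x_update)
  ultimately have 1: "dist0 (limiting_subdiff (\<lambda>z. Lagrangian f g \<phi> \<psi> z (\<xi> k) ?l) (x (Suc k))) \<le> ereal (C * norm ?d)"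
    by (intro dist0_le[OF Lagrangian_subgradient_x[OF x_in_U conjugate_psi]])
  have "norm ?d \<le> C * norm ?d" using mult_right_mono[OF C(2), of "norm ?d"] by simp
  then have 2: "dist0 (limiting_subdiff (\<lambda>\<zeta>. Lagrangian f g \<phi> \<psi> (x (Suc k)) \<zeta> ?l) (\<xi> k)) \<le> ereal (C * norm ?d)"
    by (intro dist0_le[OF Lagrangian_subgradient_\<xi>[OF x_in_U psi_lower_bound]])
  have "- (g (x (Suc k)) \<bullet> ?l) \<le> (\<beta>\<^sub>l * (norm Lgs + \<beta>\<^sub>L) + \<beta>\<^sub>R) / 2 * (norm ?d)\<^sup>2"
    using lL by (intro order_trans[OF complementarity_residual mult_right_mono]) auto
  then have "sqrt (- (g (x (Suc k)) \<bullet> ?l)) \<le> sqrt ((\<beta>\<^sub>l * (norm Lgs + \<beta>\<^sub>L) + \<beta>\<^sub>R) / 2 * (norm ?d)\<^sup>2)"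
    by (rule real_sqrt_le_mono)
  also have "\<dots> = sqrt ((\<beta>\<^sub>l * (norm Lgs + \<beta>\<^sub>L) + \<beta>\<^sub>R) / 2) * norm ?d" unfolding real_sqrt_mult by simp
  also have "\<dots> \<le> C * norm ?d" using C(3) by (intro mult_right_mono) auto
  finally have 3: "ereal (sqrt (- (g (x (Suc k)) \<bullet> ?l))) \<le> ereal (C * norm ?d)" by simp
  from 1 2 3 show ?thesis by (simp add: KKT_residual_def)
qed

text \<open>The smallest of the K + 1 squared steps is at most their average. The objective at
  \<open>x (Suc K)\<close> is at least the optimal value, and both values in the gap are finite, so
  its conversion to a real is faithful.\<close>

lemma short_step_exists:
  "\<exists>k\<le>K. norm (x (Suc k) - x k) \<le>
    sqrt (2 * real_of_ereal (objective f g \<phi> \<psi> (x 0) - opt_val f g \<phi> \<psi>) / \<alpha>) / sqrt (real K + 1)"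
proof -
  obtain m where m: "opt_val f g \<phi> \<psi> = ereal m" "\<And>z. z \<in> feasible g \<Longrightarrow> m \<le> F z"
    using opt_val_real by blast
  let ?G = "2 * (F (x 0) - m) / \<alpha>"
  have gap: "real_of_ereal (objective f g \<phi> \<psi> (x 0) - opt_val f g \<phi> \<psi>) = F (x 0) - m"
    by (simp add: objective_feasible[OF x_feasible] m(1))
  have "(\<Sum>k<Suc K. (norm (x (Suc k) - x k))\<^sup>2) \<le> 2 * (F (x 0) - F (x (Suc K))) / \<alpha>" by (rule sum_steps_le)
  also have "\<dots> \<le> ?G"
    using m(2)[OF x_feasible[of "Suc K"]] params by (intro divide_right_mono mult_left_mono) auto
  finally have S: "(\<Sum>k<Suc K. (norm (x (Suc k) - x k))\<^sup>2) \<le> ?G" .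
  have "\<exists>k<Suc K. (norm (x (Suc k) - x k))\<^sup>2 \<le> ?G / (real K + 1)"
  proof (rule ccontr)
    assume "\<not> ?thesis"
    then have "(\<Sum>k<Suc K. ?G / (real K + 1)) < (\<Sum>k<Suc K. (norm (x (Suc k) - x k))\<^sup>2)"
      by (intro sum_strict_mono) (auto simp: not_le)
    moreover have "(\<Sum>k<Suc K. ?G / (real K + 1)) = ?G"
      unfolding sum_constant by (simp add: add.commute)
    ultimately show False using S by linarith
  qed
  then obtain k where k: "k \<le> K" "(norm (x (Suc k) - x k))\<^sup>2 \<le> ?G / (real K + 1)"
    using less_Suc_eq_le by blast
  from real_sqrt_le_mono[OF k(2)] have "norm (x (Suc k) - x k) \<le> sqrt ?G / sqrt (real K + 1)"
    by (simp only: real_sqrt_divide) simp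
  with k(1) show ?thesis unfolding gap by blast
qed

end

text \<open>The existence conjunct keeps the second one, which is conditional on the constants, from
  being vacuous.\<close>

theorem theorem11:
  fixes f :: "real ^ 'n \<Rightarrow> ereal"
    and g :: "real ^ 'n \<Rightarrow> real ^ 'm"
    and \<phi> \<psi> :: "real ^ 'n \<Rightarrow> real"
    and U :: "(real ^ 'n) set"
    and \<mu>min \<mu>max Lmin Lmax M \<beta>\<^sub>R \<beta>\<^sub>F \<alpha> \<tau> :: real
    and x \<xi> :: "nat \<Rightarrow> real ^ 'n"
    and jj :: "nat \<Rightarrow> nat"
    and \<mu> :: "nat \<Rightarrow> nat \<Rightarrow> real"
    and L :: "nat \<Rightarrow> nat \<Rightarrow> real ^ 'm"
    and Q :: "nat \<Rightarrow> nat \<Rightarrow> real ^ 'n \<Rightarrow> real ^ 'n"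
    and xbar y v :: "nat \<Rightarrow> nat \<Rightarrow> real ^ 'n"
    and lam :: "nat \<Rightarrow> nat \<Rightarrow> real ^ 'm"
    and Lf :: real
    and Lgs :: "real ^ 'm"
  assumes algorithm: "inexact_MBA f g \<phi> \<psi> U \<mu>min \<mu>max Lmin Lmax M \<beta>\<^sub>R \<beta>\<^sub>F \<alpha> \<tau>
                        x \<xi> jj \<mu> L Q xbar y v lam"
    and bounded: "bounded (range x)"
    and MFCQ: "\<forall>z\<in>feasible g. MFCQ_at g z"
    and f_Lipschitz: "Lf-lipschitz_on U (grad (\<lambda>z. real_of_ereal (f z)))"
    and g_Lipschitz: "\<forall>i. (Lgs $ i)-lipschitz_on U (grad (\<lambda>z. g z $ i))"
  shows "(\<exists>c\<^sub>R \<beta>\<^sub>l \<beta>\<^sub>L \<beta>\<^sub>Q. MBA_iterate_bounds \<beta>\<^sub>R x (\<lambda>k. lam k (jj k)) (\<lambda>k. L k (jj k))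
             (\<lambda>k. Q k (jj k)) c\<^sub>R \<beta>\<^sub>l \<beta>\<^sub>L \<beta>\<^sub>Q) \<and>
    (\<forall>c\<^sub>R \<beta>\<^sub>l \<beta>\<^sub>L \<beta>\<^sub>Q. MBA_iterate_bounds \<beta>\<^sub>R x (\<lambda>k. lam k (jj k)) (\<lambda>k. L k (jj k))
             (\<lambda>k. Q k (jj k)) c\<^sub>R \<beta>\<^sub>l \<beta>\<^sub>L \<beta>\<^sub>Q \<longrightarrow>
       (let Lg = norm Lgs;
            C = Max {Lf + c\<^sub>R + \<beta>\<^sub>Q + \<beta>\<^sub>l * (Lg + \<beta>\<^sub>L), 1, sqrt ((\<beta>\<^sub>l * (Lg + \<beta>\<^sub>L) + \<beta>\<^sub>R) / 2)};
            gap = real_of_ereal (objective f g \<phi> \<psi> (x 0) - opt_val f g \<phi> \<psi>)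
        in (\<forall>K::nat. (MIN k\<in>{0..K}. KKT_residual f g \<phi> \<psi> (x (Suc k)) (\<xi> k) (lam k (jj k)))
               \<le> ereal (C / sqrt (real K + 1) * sqrt (2 * gap / \<alpha>))) \<and>
           (\<forall>\<epsilon>>0. \<forall>K::nat. \<lceil>2 * C\<^sup>2 * gap / (\<alpha> * \<epsilon>\<^sup>2) - 1\<rceil> \<le> int K \<longrightarrow>
               (\<exists>k\<in>{0..K}. eps_KKT_point f g \<phi> \<psi> \<epsilon> (x (Suc k)) (\<xi> k) (lam k (jj k))))))"
proof -
  interpret Lipschitz_MBA f g \<phi> \<psi> U \<mu>min \<mu>max Lmin Lmax M \<beta>\<^sub>R \<beta>\<^sub>F \<alpha> \<tau>
      x \<xi> jj \<mu> L Q xbar y v lam Lf Lgs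
    using algorithm bounded f_Lipschitz g_Lipschitz
    by (simp add: Lipschitz_MBA_def Lipschitz_MBA_axioms_def)
  let ?res = "\<lambda>k. KKT_residual f g \<phi> \<psi> (x (Suc k)) (\<xi> k) (lam k (jj k))"
  define gap where "gap = real_of_ereal (objective f g \<phi> \<psi> (x 0) - opt_val f g \<phi> \<psi>)"
  have main: "(\<forall>K::nat. (MIN k\<in>{0..K}. ?res k) \<le> ereal (C / sqrt (real K + 1) * sqrt (2 * gap / \<alpha>))) \<and>
      (\<forall>\<epsilon>>0. \<forall>K::nat. \<lceil>2 * C\<^sup>2 * gap / (\<alpha> * \<epsilon>\<^sup>2) - 1\<rceil> \<le> int K \<longrightarrow>
        (\<exists>k\<in>{0..K}. eps_KKT_point f g \<phi> \<psi> \<epsilon> (x (Suc k)) (\<xi> k) (lam k (jj k))))"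
    if bds: "MBA_iterate_bounds \<beta>\<^sub>R x (\<lambda>k. lam k (jj k)) (\<lambda>k. L k (jj k)) (\<lambda>k. Q k (jj k)) c\<^sub>R \<beta>\<^sub>l \<beta>\<^sub>L \<beta>\<^sub>Q"
      and C_def: "C = Max {Lf + c\<^sub>R + \<beta>\<^sub>Q + \<beta>\<^sub>l * (norm Lgs + \<beta>\<^sub>L), 1, sqrt ((\<beta>\<^sub>l * (norm Lgs + \<beta>\<^sub>L) + \<beta>\<^sub>R) / 2)}"
    for c\<^sub>R \<beta>\<^sub>l \<beta>\<^sub>L \<beta>\<^sub>Q C
  proof -
    have C: "Lf + c\<^sub>R + \<beta>\<^sub>Q + \<beta>\<^sub>l * (norm Lgs + \<beta>\<^sub>L) \<le> C" "1 \<le> C"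
      "sqrt ((\<beta>\<^sub>l * (norm Lgs + \<beta>\<^sub>L) + \<beta>\<^sub>R) / 2) \<le> C"
      by (auto simp: C_def)
    have rate: "\<exists>k\<in>{0..K}. ?res k \<le> ereal (C / sqrt (real K + 1) * sqrt (2 * gap / \<alpha>))" for K
    proof -
      obtain k where k: "k \<le> K" "norm (x (Suc k) - x k) \<le> sqrt (2 * gap / \<alpha>) / sqrt (real K + 1)"
        using short_step_exists unfolding gap_def by blast
      have "C * norm (x (Suc k) - x k) \<le> C * (sqrt (2 * gap / \<alpha>) / sqrt (real K + 1))"
        using k(2) C(2) by (intro mult_left_mono) auto
      with KKT_residual_le[OF bds C, of k] have "?res k \<le> ereal (C * (sqrt (2 * gap / \<alpha>) / sqrt (real K + 1)))"
        by (meson ereal_less_eq(3) order_trans)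
      with k(1) show ?thesis by (intro bexI[of _ k]) (auto simp: mult_ac)
    qed
    have "(MIN k\<in>{0..K}. ?res k) \<le> ereal (C / sqrt (real K + 1) * sqrt (2 * gap / \<alpha>))" for K
    proof -
      obtain k where "k \<in> {0..K}" "?res k \<le> ereal (C / sqrt (real K + 1) * sqrt (2 * gap / \<alpha>))"
        using rate by blast
      then show ?thesis by (intro order_trans[OF Min_le[of "?res ` {0..K}" "?res k"]]) auto
    qed
    moreover have "\<exists>k\<in>{0..K}. eps_KKT_point f g \<phi> \<psi> \<epsilon> (x (Suc k)) (\<xi> k) (lam k (jj k))"
      if \<epsilon>: "\<epsilon> > 0" and K: "\<lceil>2 * C\<^sup>2 * gap / (\<alpha> * \<epsilon>\<^sup>2) - 1\<rceil> \<le> int K" for \<epsilon> :: real and K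
    proof -
      \<comment> \<open>The ceiling drops out because K is an integer; the - 1 matches the K + 1
        steps numbered from 0 to K.\<close>
      have "2 * C\<^sup>2 * gap / (\<alpha> * \<epsilon>\<^sup>2) \<le> real K + 1" using K[unfolded ceiling_le_iff] by simp
      then have "C\<^sup>2 * (2 * gap / \<alpha>) / (real K + 1) \<le> \<epsilon>\<^sup>2"
      proof -
        assume "2 * C\<^sup>2 * gap / (\<alpha> * \<epsilon>\<^sup>2) \<le> real K + 1"
        then have "2 * C\<^sup>2 * gap \<le> (real K + 1) * (\<alpha> * \<epsilon>\<^sup>2)"
          using \<epsilon> params(8) by (subst (asm) pos_divide_le_eq) auto
        then have "2 * C\<^sup>2 * gap / (\<alpha> * (real K + 1)) \<le> \<epsilon>\<^sup>2"
          using params(8) by (subst pos_divide_le_eq) (auto simp: mult_ac)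
        then show ?thesis by (simp add: mult_ac)
      qed
      then have "sqrt (C\<^sup>2 * (2 * gap / \<alpha>) / (real K + 1)) \<le> sqrt (\<epsilon>\<^sup>2)" by (rule real_sqrt_le_mono)
      then have "C / sqrt (real K + 1) * sqrt (2 * gap / \<alpha>) \<le> \<epsilon>"
        using \<epsilon> C(2) by (simp add: real_sqrt_divide real_sqrt_mult mult_ac)
      moreover obtain k where k: "k \<in> {0..K}" "?res k \<le> ereal (C / sqrt (real K + 1) * sqrt (2 * gap / \<alpha>))"
        using rate by blast
      ultimately have "?res k \<le> ereal \<epsilon>" by (meson ereal_less_eq(3) order_trans)
      with k(1) show ?thesis
        \<comment> \<open>The residual bound alone does not make an \<epsilon>-KKT point:
          feasibility, a finite conjugate at - \<xi>^k and nonnegative multipliers are part of the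
          definition.\<close>
        using x_feasible[of "Suc k"] lam_nonneg[of "jj k" k]
        by (intro bexI[of _ k]) (auto simp: eps_KKT_point_def conjugate_psi)
    qed
    ultimately show ?thesis by blast
  qed
  from iterate_bounds_exist[OF MFCQ] main[OF _ refl] show ?thesis
    unfolding Let_def gap_def by blast
qed

end
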